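(* Let $(\mathcal{X},\mu)$ be a measure space and let $M$ be an exponential family on $\mathcal{X}$ with Fisher metric $h$ and exponential connection $\nabla^{(1)}$. Let $(g,J,\omega)$ be the almost Hermitian structure on $TM$ given by Dombrowski's construction from $h$ and $\nabla^{(1)}$. Let $\Phi:TM\to L^2(\mathcal{X})$ be the map $[\Phi(p,v)](x)=\sqrt{p(x)}\exp\left(\frac{i\,v(x)}{2}\right)$ (whose image lies in the unit sphere), let $\pi_{\mathbb{P}}:L^2(\mathcal{X})\setminus\{0\}\to\mathbb{P}L^2(\mathcal{X})$ be the projection onto the complex projective space, and let $g_{FS},\omega_{FS}$ be the Fubini-Study metric and symplectic form on $\mathbb{P}L^2(\mathcal{X})$. Then $$(\pi_{\mathbb{P}}\circ\Phi)^*g_{FS}=\tfrac14\, g,\qquad (\pi_{\mathbb{P}}\circ\Phi)^*\omega_{FS}=\tfrac14\,\omega .$$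
   Context: Exponential family: $M=\{p_\theta(x)=\exp(C(x)+\sum_{k=1}^n\theta^kF_k(x)-\psi(\theta)) : \theta\in E\}$, where $E\subset\mathbb{R}^n$ is open, $C,F_1,\dots,F_n:\mathcal{X}\to\mathbb{R}$ are measurable, $1,F_1,\dots,F_n$ are linearly independent, and $\psi(\theta)=\ln\int_{\mathcal{X}}\exp(C+\sum_k\theta^kF_k)\,d\mu$ is the (finite) normalizing function, so that each $p_\theta$ is a probability density with respect to $\mu$. $M$ is a manifold with global chart $\theta=(\theta^1,\dots,\theta^n)$ (the natural parameters). Tangent vectors as functions: $v\in T_pM$ is identified with the function $v:\mathcal{X}\to\mathbb{R}$ defined by $p(x)v(x)=\frac{d}{dt}\big|_{t=0}p_t(x)$, where $p_t$ is a curve in $M$ with $p_0=p$, $\dot p_0=v$. Standing assumption: $\frac{d}{dt}\int_{\mathcal X} p_t\,d\mu=\int_{\mathcal X}\frac{d}{dt}p_t\,d\mu$ for such curves, and $\Phi$ is Gâteaux differentiable as a map to $L^2(\mathcal{X})$, its derivative being computed by pointwise differentiation in $x$. Fisher metric: $h_p(u,\tilde u)=\int_{\mathcal{X}}u(x)\tilde u(x)\,p(x)\,d\mu(x)$ for $u,\tilde u\in T_pM$; equivalently $h_{ij}=\mathbb{E}[\partial_i\ell_\theta\,\partial_j\ell_\theta]$ with $\ell_\theta=\ln p_\theta$. Exponential connection $\nabla^{(1)}$: the affine connection with Christoffel symbols $\Gamma^{(1)}_{ij,k}=\mathbb{E}[(\partial_i\partial_j\ell_\theta)(\partial_k\ell_\theta)]$;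 on an exponential family it is flat and the natural parameters are affine coordinates for it. Dombrowski's construction: let $\pi:TM\to M$ be the bundle projection and $K:T(TM)\to TM$ the connector of $\nabla^{(1)}$ (so that $K(\frac{d}{dt}|_{0}(p_t,v_t))$ is the covariant derivative of $v_t$ along $p_t$ at $t=0$). A vector $Z\in T_{(p,v)}(TM)$ has horizontal component $l=\pi_*Z\in T_pM$ and vertical component $u=K(Z)\in T_pM$; this identifies $T_{(p,v)}(TM)\simeq T_pM\oplus T_pM$, $Z\leftrightarrow(l,u)$. Then $g((l,u),(l',u'))=h_p(l,l')+h_p(u,u')$, $\omega((l,u),(l',u'))=h_p(l,u')-h_p(u,l')$, $J(l,u)=(-u,l)$. $L^2(\mathcal{X})$ is the space of complex-valued square-integrable functions with inner product $\langle f_1,f_2\rangle=\int_{\mathcal X}\bar f_1f_2\,d\mu$ (conjugate-linear in the first slot). Fubini-Study structure on $\mathbb{P}L^2(\mathcal{X})$ (possibly infinite-dimensional): for a unit vector $z_0$, use the chart $\phi_{z_0}:\{[z]:\langle z_0,z\rangle\ne0\}\to z_0^\perp$, $[z]\mapsto\frac{z}{\langle z_0,z\rangle}-z_0$. At the point $[z_0]$, $g_{FS}+i\omega_{FS}$ is the pullback by $\phi_{z_0}$ of the Hermitian inner product of $z_0^\perp$. Thus for curves $z_1(t),z_2(t)$ on the unit sphere with $z_1(0)=z_2(0)=z_0$, $(g_{FS}+i\omega_{FS})\big(\frac{d}{dt}|_0[z_1],\frac{d}{dt}|_0[z_2]\big)=\langle\dot z_1(0),\dot z_2(0)\rangle-\langle\dot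 z_1(0),z_0\rangle\langle z_0,\dot z_2(0)\rangle$. *)

theory Defs
  imports "HOL-Analysis.Analysis"
begin

section \<open>Exponential families\<close>

(* A family on the measure space mu is given by C, by F :: 'n => _ with 'n the index type of the
   natural parameters, and by the open parameter domain E.  As usual for functions relative to a
   measure, the sample space is the carrier space mu. *)

definition log_partition ::
  "'x measure \<Rightarrow> ('x \<Rightarrow> real) \<Rightarrow> ('n::finite \<Rightarrow> 'x \<Rightarrow> real) \<Rightarrow> real^'n \<Rightarrow> real" where
  "log_partition \<mu> C F \<theta> = ln (\<integral>x. exp (C x + (\<Sum>k\<in>UNIV. \<theta> $ k * F k x)) \<partial>\<mu>)"

definition ef_density ::
  "'x measure \<Rightarrow> ('x \<Rightarrow> real) \<Rightarrow> ('n::finite \<Rightarrow> 'x \<Rightarrow> real) \<Rightarrow> real^'n \<Rightarrow> 'x \<Rightarrow> real" where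
  "ef_density \<mu> C F \<theta> x = exp (C x + (\<Sum>k\<in>UNIV. \<theta> $ k * F k x) - log_partition \<mu> C F \<theta>)"

(* The normalising integral is required to be finite (integrability) and positive: ln and the
   Bochner integral are total, so this is what makes log_partition the genuine finite psi and every
   ef_density a probability density.  Linear independence is that of functions on the sample space;
   it makes (theta, eta) |-> (p, v) injective.  If it fails modulo null sets the Fisher matrix is
   singular; that case is not excluded. *)
definition exponential_family ::
  "'x measure \<Rightarrow> (real^'n) set \<Rightarrow> ('x \<Rightarrow> real) \<Rightarrow> ('n::finite \<Rightarrow> 'x \<Rightarrow> real) \<Rightarrow> bool" where
  "exponential_family \<mu> E C F \<longleftrightarrow>
     open E \<and>
     C \<in> borel_measurable \<mu> \<and> (\<forall>k. F k \<in> borel_measurable \<mu>) \<and>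
     (\<forall>a b. (\<forall>x\<in>space \<mu>. a + (\<Sum>k\<in>UNIV. b k * F k x) = 0) \<longrightarrow> a = 0 \<and> (\<forall>k. b k = 0)) \<and>
     (\<forall>\<theta>\<in>E. integrable \<mu> (\<lambda>x. exp (C x + (\<Sum>k\<in>UNIV. \<theta> $ k * F k x))) \<and>
             0 < (\<integral>x. exp (C x + (\<Sum>k\<in>UNIV. \<theta> $ k * F k x)) \<partial>\<mu>))"


section \<open>Tangent bundle, Fisher metric, exponential connection\<close>

(* The function v with p v = (d/dt) p_t at t = 0, for the tangent vector at p_theta with coordinates
   eta in the chart theta; the curve used is the coordinate line with velocity eta. *)
definition tangent_fun ::
  "'x measure \<Rightarrow> ('x \<Rightarrow> real) \<Rightarrow> ('n::finite \<Rightarrow> 'x \<Rightarrow> real) \<Rightarrow> real^'n \<Rightarrow> real^'n \<Rightarrow> 'x \<Rightarrow> real" where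
  "tangent_fun \<mu> C F \<theta> \<eta> x =
     deriv (\<lambda>t::real. ef_density \<mu> C F (\<theta> + t *\<^sub>R \<eta>) x) 0 / ef_density \<mu> C F \<theta> x"

(* The global chart theta of M makes E \<times> UNIV, with coordinates (theta, eta), a global chart of TM;
   tm_point sends coordinates to the actual pair (p, v) of functions.  A tangent vector to TM at
   q = (theta, eta) is given by its coordinates Z = (a, b). *)
definition tm_point ::
  "'x measure \<Rightarrow> ('x \<Rightarrow> real) \<Rightarrow> ('n::finite \<Rightarrow> 'x \<Rightarrow> real) \<Rightarrow> (real^'n) \<times> (real^'n)
     \<Rightarrow> ('x \<Rightarrow> real) \<times> ('x \<Rightarrow> real)" where
  "tm_point \<mu> C F q = (ef_density \<mu> C F (fst q), tangent_fun \<mu> C F (fst q) (snd q))"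

definition fisher :: "'x measure \<Rightarrow> ('x \<Rightarrow> real) \<Rightarrow> ('x \<Rightarrow> real) \<Rightarrow> ('x \<Rightarrow> real) \<Rightarrow> real" where
  "fisher \<mu> p u u' = (\<integral>x. u x * u' x * p x \<partial>\<mu>)"

definition fisher_matrix ::
  "'x measure \<Rightarrow> ('x \<Rightarrow> real) \<Rightarrow> ('n::finite \<Rightarrow> 'x \<Rightarrow> real) \<Rightarrow> real^'n \<Rightarrow> real^'n^'n" where
  "fisher_matrix \<mu> C F \<theta> =
     (\<chi> i j. fisher \<mu> (ef_density \<mu> C F \<theta>)
        (tangent_fun \<mu> C F \<theta> (axis i 1)) (tangent_fun \<mu> C F \<theta> (axis j 1)))"

definition partial_deriv :: "'n::finite \<Rightarrow> (real^'n \<Rightarrow> real) \<Rightarrow> real^'n \<Rightarrow> real" where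
  "partial_deriv i f \<theta> = deriv (\<lambda>t. f (\<theta> + t *\<^sub>R axis i 1)) 0"

definition log_likelihood ::
  "'x measure \<Rightarrow> ('x \<Rightarrow> real) \<Rightarrow> ('n::finite \<Rightarrow> 'x \<Rightarrow> real) \<Rightarrow> 'x \<Rightarrow> real^'n \<Rightarrow> real" where
  "log_likelihood \<mu> C F x \<theta> = ln (ef_density \<mu> C F \<theta> x)"

(* Christoffel symbols of the first kind, Gamma_{ij,k} = E[(d_i d_j l) (d_k l)] ... *)
definition christoffel1 ::
  "'x measure \<Rightarrow> ('x \<Rightarrow> real) \<Rightarrow> ('n::finite \<Rightarrow> 'x \<Rightarrow> real) \<Rightarrow> real^'n \<Rightarrow> 'n \<Rightarrow> 'n \<Rightarrow> 'n \<Rightarrow> real" where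
  "christoffel1 \<mu> C F \<theta> i j k =
     (\<integral>x. partial_deriv i (partial_deriv j (log_likelihood \<mu> C F x)) \<theta>
          * partial_deriv k (log_likelihood \<mu> C F x) \<theta> * ef_density \<mu> C F \<theta> x \<partial>\<mu>)"

(* ... and of the second kind, Gamma^k_{ij} = h^{kl} Gamma_{ij,l}. *)
definition christoffel2 ::
  "'x measure \<Rightarrow> ('x \<Rightarrow> real) \<Rightarrow> ('n::finite \<Rightarrow> 'x \<Rightarrow> real) \<Rightarrow> real^'n \<Rightarrow> 'n \<Rightarrow> 'n \<Rightarrow> 'n \<Rightarrow> real" where
  "christoffel2 \<mu> C F \<theta> i j k =
     (\<Sum>l\<in>UNIV. matrix_inv (fisher_matrix \<mu> C F \<theta>) $ k $ l * christoffel1 \<mu> C F \<theta> i j l)"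

(* Coordinates of K(Z): the covariant derivative of a vector field (eta_t) along (theta_t) with
   theta' = a and eta' = b is b^k + Gamma^k_{ij} a^i eta^j. *)
definition connector ::
  "'x measure \<Rightarrow> ('x \<Rightarrow> real) \<Rightarrow> ('n::finite \<Rightarrow> 'x \<Rightarrow> real) \<Rightarrow> (real^'n) \<times> (real^'n)
     \<Rightarrow> (real^'n) \<times> (real^'n) \<Rightarrow> real^'n" where
  "connector \<mu> C F q Z =
     (\<chi> k. snd Z $ k +
        (\<Sum>i\<in>UNIV. \<Sum>j\<in>UNIV. christoffel2 \<mu> C F (fst q) i j k * fst Z $ i * snd q $ j))"


section \<open>Dombrowski's construction\<close>

definition horizontal ::
  "'x measure \<Rightarrow> ('x \<Rightarrow> real) \<Rightarrow> ('n::finite \<Rightarrow> 'x \<Rightarrow> real) \<Rightarrow> (real^'n) \<times> (real^'n)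
     \<Rightarrow> (real^'n) \<times> (real^'n) \<Rightarrow> 'x \<Rightarrow> real" where
  "horizontal \<mu> C F q Z = tangent_fun \<mu> C F (fst q) (fst Z)"

definition vertical ::
  "'x measure \<Rightarrow> ('x \<Rightarrow> real) \<Rightarrow> ('n::finite \<Rightarrow> 'x \<Rightarrow> real) \<Rightarrow> (real^'n) \<times> (real^'n)
     \<Rightarrow> (real^'n) \<times> (real^'n) \<Rightarrow> 'x \<Rightarrow> real" where
  "vertical \<mu> C F q Z = tangent_fun \<mu> C F (fst q) (connector \<mu> C F q Z)"

definition dombrowski_g ::
  "'x measure \<Rightarrow> ('x \<Rightarrow> real) \<Rightarrow> ('n::finite \<Rightarrow> 'x \<Rightarrow> real) \<Rightarrow> (real^'n) \<times> (real^'n)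
     \<Rightarrow> (real^'n) \<times> (real^'n) \<Rightarrow> (real^'n) \<times> (real^'n) \<Rightarrow> real" where
  "dombrowski_g \<mu> C F q Z Z' =
     fisher \<mu> (ef_density \<mu> C F (fst q)) (horizontal \<mu> C F q Z) (horizontal \<mu> C F q Z')
   + fisher \<mu> (ef_density \<mu> C F (fst q)) (vertical \<mu> C F q Z) (vertical \<mu> C F q Z')"

definition dombrowski_omega ::
  "'x measure \<Rightarrow> ('x \<Rightarrow> real) \<Rightarrow> ('n::finite \<Rightarrow> 'x \<Rightarrow> real) \<Rightarrow> (real^'n) \<times> (real^'n)
     \<Rightarrow> (real^'n) \<times> (real^'n) \<Rightarrow> (real^'n) \<times> (real^'n) \<Rightarrow> real" where
  "dombrowski_omega \<mu> C F q Z Z' =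
     fisher \<mu> (ef_density \<mu> C F (fst q)) (horizontal \<mu> C F q Z) (vertical \<mu> C F q Z')
   - fisher \<mu> (ef_density \<mu> C F (fst q)) (vertical \<mu> C F q Z) (horizontal \<mu> C F q Z')"


section \<open>The space of square-integrable functions and its projective space\<close>

(* Elements are represented by functions; everything below is invariant under a.e. equality. *)

definition L2 :: "'x measure \<Rightarrow> ('x \<Rightarrow> complex) set" where
  "L2 \<mu> = {f. f \<in> borel_measurable \<mu> \<and> integrable \<mu> (\<lambda>x. (cmod (f x))\<^sup>2)}"

definition l2_inner :: "'x measure \<Rightarrow> ('x \<Rightarrow> complex) \<Rightarrow> ('x \<Rightarrow> complex) \<Rightarrow> complex" where
  "l2_inner \<mu> f g = (\<integral>x. cnj (f x) * g x \<partial>\<mu>)"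

definition l2_norm :: "'x measure \<Rightarrow> ('x \<Rightarrow> complex) \<Rightarrow> real" where
  "l2_norm \<mu> f = sqrt (\<integral>x. (cmod (f x))\<^sup>2 \<partial>\<mu>)"

definition l2_sphere :: "'x measure \<Rightarrow> ('x \<Rightarrow> complex) set" where
  "l2_sphere \<mu> = {f \<in> L2 \<mu>. l2_norm \<mu> f = 1}"

(* Membership of c t in L2 near 0 is needed because l2_norm is 0 outside L2. *)
definition has_l2_derivative ::
  "'x measure \<Rightarrow> (real \<Rightarrow> 'x \<Rightarrow> complex) \<Rightarrow> ('x \<Rightarrow> complex) \<Rightarrow> bool" where
  "has_l2_derivative \<mu> c D \<longleftrightarrow>
     (\<forall>\<^sub>F t in nhds 0. c t \<in> L2 \<mu>) \<and> D \<in> L2 \<mu> \<and>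
     ((\<lambda>t. l2_norm \<mu> (\<lambda>x. (c t x - c 0 x) / of_real t - D x)) \<longlongrightarrow> 0) (at 0)"

definition l2_velocity :: "'x measure \<Rightarrow> (real \<Rightarrow> 'x \<Rightarrow> complex) \<Rightarrow> 'x \<Rightarrow> complex" where
  "l2_velocity \<mu> c = (SOME D. has_l2_derivative \<mu> c D)"

(* The point [z]: all functions that agree a.e. with a nonzero complex multiple of z. *)
definition proj :: "'x measure \<Rightarrow> ('x \<Rightarrow> complex) \<Rightarrow> ('x \<Rightarrow> complex) set" where
  "proj \<mu> z = {w \<in> L2 \<mu>. \<exists>k. k \<noteq> 0 \<and> (AE x in \<mu>. w x = k * z x)}"

definition proj_space :: "'x measure \<Rightarrow> ('x \<Rightarrow> complex) set set" where
  "proj_space \<mu> = proj \<mu> ` {z \<in> L2 \<mu>. l2_norm \<mu> z \<noteq> 0}"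

definition fs_chart_domain :: "'x measure \<Rightarrow> ('x \<Rightarrow> complex) \<Rightarrow> ('x \<Rightarrow> complex) set set" where
  "fs_chart_domain \<mu> z\<^sub>0 = {\<xi> \<in> proj_space \<mu>. \<forall>z\<in>\<xi>. l2_inner \<mu> z\<^sub>0 z \<noteq> 0}"

(* The chart phi_{z0}; up to a.e. equality the value does not depend on the representative z. *)
definition fs_chart ::
  "'x measure \<Rightarrow> ('x \<Rightarrow> complex) \<Rightarrow> ('x \<Rightarrow> complex) set \<Rightarrow> 'x \<Rightarrow> complex" where
  "fs_chart \<mu> z\<^sub>0 \<xi> = (let z = (SOME z. z \<in> \<xi>) in (\<lambda>x. z x / l2_inner \<mu> z\<^sub>0 z - z\<^sub>0 x))"

(* Differentiability at 0 of a curve in projective space, read off in the charts centred at the unit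
   representatives of its starting point. *)
definition proj_differentiable :: "'x measure \<Rightarrow> (real \<Rightarrow> ('x \<Rightarrow> complex) set) \<Rightarrow> bool" where
  "proj_differentiable \<mu> c \<longleftrightarrow> c 0 \<in> proj_space \<mu> \<and>
     (\<forall>z\<^sub>0\<in>c 0 \<inter> l2_sphere \<mu>.
        (\<forall>\<^sub>F t in nhds 0. c t \<in> fs_chart_domain \<mu> z\<^sub>0) \<and>
        (\<exists>D. has_l2_derivative \<mu> (\<lambda>t. fs_chart \<mu> z\<^sub>0 (c t)) D))"

(* (g_FS + i omega_FS)(c1'(0), c2'(0)) for curves with c1 0 = c2 0 = [z0]: the Hermitian product of
   the velocities in the chart phi_{z0}.  Changing the unit representative z0 by a phase factor
   multiplies both velocities by that factor, so the value does not depend on the choice. *)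
definition fubini_study ::
  "'x measure \<Rightarrow> (real \<Rightarrow> ('x \<Rightarrow> complex) set) \<Rightarrow> (real \<Rightarrow> ('x \<Rightarrow> complex) set) \<Rightarrow> complex" where
  "fubini_study \<mu> c1 c2 =
     (let z\<^sub>0 = (SOME z. z \<in> c1 0 \<inter> l2_sphere \<mu>)
      in l2_inner \<mu> (l2_velocity \<mu> (\<lambda>t. fs_chart \<mu> z\<^sub>0 (c1 t)))
                   (l2_velocity \<mu> (\<lambda>t. fs_chart \<mu> z\<^sub>0 (c2 t))))"

definition g_FS ::
  "'x measure \<Rightarrow> (real \<Rightarrow> ('x \<Rightarrow> complex) set) \<Rightarrow> (real \<Rightarrow> ('x \<Rightarrow> complex) set) \<Rightarrow> real" where
  "g_FS \<mu> c1 c2 = Re (fubini_study \<mu> c1 c2)"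

definition omega_FS ::
  "'x measure \<Rightarrow> (real \<Rightarrow> ('x \<Rightarrow> complex) set) \<Rightarrow> (real \<Rightarrow> ('x \<Rightarrow> complex) set) \<Rightarrow> real" where
  "omega_FS \<mu> c1 c2 = Im (fubini_study \<mu> c1 c2)"

(* Pullback along Psi of a bilinear form B given on velocities of curves: the differential of Psi
   takes Z to the velocity at 0 of the image of the coordinate line q + t Z. *)
definition pullback_form ::
  "('q::real_vector \<Rightarrow> 's) \<Rightarrow> ((real \<Rightarrow> 's) \<Rightarrow> (real \<Rightarrow> 's) \<Rightarrow> real) \<Rightarrow> 'q \<Rightarrow> 'q \<Rightarrow> 'q \<Rightarrow> real" where
  "pullback_form \<Psi> B q Z Z' = B (\<lambda>t. \<Psi> (q + t *\<^sub>R Z)) (\<lambda>t. \<Psi> (q + t *\<^sub>R Z'))"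


section \<open>The map Phi and the standing assumptions\<close>

definition Phi :: "('x \<Rightarrow> real) \<times> ('x \<Rightarrow> real) \<Rightarrow> 'x \<Rightarrow> complex" where
  "Phi = (\<lambda>(p, v) x. complex_of_real (sqrt (p x)) * exp (\<i> * complex_of_real (v x) / 2))"

(* The composite of the projection to projective space with Phi, in the coordinates q of TM. *)
definition proj_Phi ::
  "'x measure \<Rightarrow> ('x \<Rightarrow> real) \<Rightarrow> ('n::finite \<Rightarrow> 'x \<Rightarrow> real) \<Rightarrow> (real^'n) \<times> (real^'n)
     \<Rightarrow> ('x \<Rightarrow> complex) set" where
  "proj_Phi \<mu> C F q = proj \<mu> (Phi (tm_point \<mu> C F q))"

(* Germ at 0 of a smooth curve in E; D n is the n-th derivative. *)
definition smooth_curve_at_0 :: "(real^'n::finite) set \<Rightarrow> (real \<Rightarrow> real^'n) \<Rightarrow> bool" where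
  "smooth_curve_at_0 E \<gamma> \<longleftrightarrow>
     (\<exists>\<epsilon>>0. \<gamma> ` {-\<epsilon><..<\<epsilon>} \<subseteq> E \<and>
        (\<exists>D::nat \<Rightarrow> real \<Rightarrow> real^'n. D 0 = \<gamma> \<and>
           (\<forall>n. \<forall>t\<in>{-\<epsilon><..<\<epsilon>}. (D n has_vector_derivative D (Suc n) t) (at t))))"

definition differentiates_under_integral ::
  "'x measure \<Rightarrow> (real^'n) set \<Rightarrow> ('x \<Rightarrow> real) \<Rightarrow> ('n::finite \<Rightarrow> 'x \<Rightarrow> real) \<Rightarrow> bool" where
  "differentiates_under_integral \<mu> E C F \<longleftrightarrow>
     (\<forall>\<gamma>. smooth_curve_at_0 E \<gamma> \<longrightarrow>
        (\<forall>x\<in>space \<mu>. (\<lambda>t. ef_density \<mu> C F (\<gamma> t) x) field_differentiable (at 0)) \<and>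
        integrable \<mu> (\<lambda>x. deriv (\<lambda>t. ef_density \<mu> C F (\<gamma> t) x) 0) \<and>
        ((\<lambda>t. \<integral>x. ef_density \<mu> C F (\<gamma> t) x \<partial>\<mu>) has_real_derivative
          (\<integral>x. deriv (\<lambda>t. ef_density \<mu> C F (\<gamma> t) x) 0 \<partial>\<mu>)) (at 0))"

definition Phi_Gateaux_differentiable ::
  "'x measure \<Rightarrow> (real^'n) set \<Rightarrow> ('x \<Rightarrow> real) \<Rightarrow> ('n::finite \<Rightarrow> 'x \<Rightarrow> real) \<Rightarrow> bool" where
  "Phi_Gateaux_differentiable \<mu> E C F \<longleftrightarrow>
     (\<forall>q\<in>E \<times> UNIV. \<forall>Z. \<exists>D.
        (AE x in \<mu>. ((\<lambda>t. Phi (tm_point \<mu> C F (q + t *\<^sub>R Z)) x) has_vector_derivative D x) (at 0)) \<and>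
        has_l2_derivative \<mu> (\<lambda>t. Phi (tm_point \<mu> C F (q + t *\<^sub>R Z))) D)"

end

theory Submission
  imports Defs
begin

text \<open>
  Write \<open>T = (F\<^sub>1, \<dots>, F\<^sub>n)\<close> for the vector of statistics and \<open>m(\<theta>)\<close> for its mean under
  \<open>p\<^sub>\<theta>\<close>.  Differentiating \<open>\<integral>p\<^sub>\<theta> d\<mu> = 1\<close> shows that the gradient of the potential
  \<open>\<psi>\<close> is \<open>m\<close>, so the tangent vector with coordinates \<open>v\<close> is the function
  \<open>v \<bullet> (T - m(\<theta>))\<close>, its score, which has mean zero.  The score depends on
  the sample point only through \<open>v \<bullet> T\<close>, in which \<open>\<theta>\<close> does not occur, so the second derivatives
  of \<open>ln p\<^sub>\<theta>\<close> are constant on the sample space.  Being integrated against a score, they give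
  vanishing Christoffel symbols; hence the vertical component of \<open>Z = (a, b)\<close> at \<open>(\<theta>, \<eta>)\<close> has
  coordinates \<open>b\<close> (\<open>connector_eq_snd\<close>), and the horizontal one has coordinates \<open>a\<close>.

  Along \<open>(\<theta> + t a, \<eta> + t b)\<close> the map \<open>\<Phi>\<close> is the product of
  \<open>exp ((C + \<theta>\<^sub>t \<bullet> T - \<psi>(\<theta>\<^sub>t)) / 2 + i \<eta>\<^sub>t \<bullet> T / 2)\<close> and of the phase
  \<open>exp (- i \<eta>\<^sub>t \<bullet> m(\<theta>\<^sub>t) / 2)\<close>, which is constant on the sample space.  The derivative of
  that phase therefore contributes only a multiple of \<open>\<Phi>\<close> to the velocity: with \<open>l\<close> and \<open>u\<close> the
  scores of \<open>a\<close> and \<open>b\<close>, the velocity is \<open>\<Phi> (l + i u + const) / 2\<close> (\<open>Phi_velocity\<close>).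

  The chart of projective space at a unit vector \<open>z\<close> sends the velocity \<open>D\<close> of a curve from \<open>z\<close>
  to \<open>D - \<langle>z, D\<rangle> z\<close>, up to a phase that drops out of Hermitian products
  (\<open>fubini_study_curves\<close>).  Since scores have mean zero, this removes exactly the constant and leaves
  \<open>\<Phi> (l + i u) / 2\<close>.  As \<open>\<bar>\<Phi>\<bar>\<^sup>2 = p\<^sub>\<theta>\<close>, the Hermitian product of two such
  vectors is a quarter of the mean of \<open>(l - i u) (l' + i u')\<close>, whose real and imaginary parts are
  Dombrowski's metric and symplectic form.
\<close>

section \<open>Derivatives of functions of a real variable\<close>

text \<open>Valid also when \<open>f\<close> is not differentiable: adding a constant does not change which numbers
  are derivatives, and \<open>deriv\<close> is a choice among these.\<close>

lemma deriv_const_diff_cong: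
  fixes f :: "real \<Rightarrow> real"
  shows "deriv (\<lambda>t. a - f t) s = deriv (\<lambda>t. b - f t) s"
proof -
  have "((\<lambda>t. d - f t) has_real_derivative D) (at s)"
    if "((\<lambda>t. c - f t) has_real_derivative D) (at s)" for c d D
    using DERIV_add[OF DERIV_const[of "d - c"] that] by simp
  then have "((\<lambda>t. a - f t) has_real_derivative D) (at s)
      \<longleftrightarrow> ((\<lambda>t. b - f t) has_real_derivative D) (at s)" for D
    by blast
  then show ?thesis by (simp add: deriv_def)
qed

lemma has_vector_derivative_eventually_eq:
  assumes "(f has_vector_derivative D) (at s)" "\<forall>\<^sub>F t in nhds s. g t = f t"
  shows "(g has_vector_derivative D) (at s)"
  by (rule has_vector_derivative_cong_ev[THEN iffD2, OF _ _ assms(1)])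
     (use assms(2) in \<open>auto dest: eventually_nhds_x_imp_x\<close>)

lemma has_vector_derivative_at_0_iff_quotient:
  fixes f :: "real \<Rightarrow> complex"
  shows "(f has_vector_derivative D) (at 0) \<longleftrightarrow> ((\<lambda>t. (f t - f 0) / of_real t) \<longlongrightarrow> D) (at 0)"
proof -
  have "(f has_vector_derivative D) (at 0)
      \<longleftrightarrow> ((\<lambda>t. (1 / norm t) *\<^sub>R (f t - (f 0 + t *\<^sub>R D))) \<longlongrightarrow> 0) (at 0)"
    by (simp add: has_vector_derivative_def has_derivative_within bounded_linear_scaleR_left)
  also have "\<dots> \<longleftrightarrow> ((\<lambda>t. norm ((1 / norm t) *\<^sub>R (f t - (f 0 + t *\<^sub>R D)))) \<longlongrightarrow> 0) (at 0)"
    by (rule tendsto_norm_zero_iff[symmetric])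
  also have "\<dots> \<longleftrightarrow> ((\<lambda>t. norm ((f t - f 0) / of_real t - D)) \<longlongrightarrow> 0) (at 0)"
  proof (rule filterlim_cong[OF refl refl])
    have "norm ((1 / norm t) *\<^sub>R (f t - (f 0 + t *\<^sub>R D))) = norm ((f t - f 0) / of_real t - D)"
      if "t \<noteq> 0" for t
    proof -
      have "(f t - f 0) / of_real t - D = (f t - (f 0 + t *\<^sub>R D)) / of_real t"
        using that by (simp add: field_simps scaleR_conv_of_real)
      then show ?thesis by (simp add: norm_divide)
    qed
    then show "\<forall>\<^sub>F t in at 0. norm ((1 / norm t) *\<^sub>R (f t - (f 0 + t *\<^sub>R D)))
        = norm ((f t - f 0) / of_real t - D)"
      by (auto simp: eventually_at_filter)
  qed
  also have "\<dots> \<longleftrightarrow> ((\<lambda>t. (f t - f 0) / of_real t) \<longlongrightarrow> D) (at 0)"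
    by (simp only: tendsto_norm_zero_iff LIM_zero_iff)
  finally show ?thesis .
qed

section \<open>The semi-inner-product space of square-integrable functions\<close>

lemma L2_measurable: "f \<in> L2 \<mu> \<Longrightarrow> f \<in> borel_measurable \<mu>"
  by (simp add: L2_def)

lemma L2_integrable_square: "f \<in> L2 \<mu> \<Longrightarrow> integrable \<mu> (\<lambda>x. (cmod (f x))\<^sup>2)"
  by (simp add: L2_def)

lemma L2_cong_AE:
  assumes "f \<in> L2 \<mu>" "g \<in> borel_measurable \<mu>" "AE x in \<mu>. f x = g x"
  shows "g \<in> L2 \<mu>"
proof -
  have "integrable \<mu> (\<lambda>x. (cmod (g x))\<^sup>2)"
    by (rule integrable_cong_AE_imp[OF L2_integrable_square[OF assms(1)]])
       (use assms in auto)
  with assms(2) show ?thesis by (simp add: L2_def)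
qed

lemma L2_scale: "f \<in> L2 \<mu> \<Longrightarrow> (\<lambda>x. c * f x) \<in> L2 \<mu>"
  by (auto simp: L2_def norm_mult power_mult_distrib)

lemma L2_add:
  assumes "f \<in> L2 \<mu>" "g \<in> L2 \<mu>"
  shows "(\<lambda>x. f x + g x) \<in> L2 \<mu>"
proof -
  have [measurable]: "f \<in> borel_measurable \<mu>" "g \<in> borel_measurable \<mu>"
    using assms by (auto simp: L2_def)
  have le: "(cmod (a + b))\<^sup>2 \<le> 2 * (cmod a)\<^sup>2 + 2 * (cmod b)\<^sup>2" for a b
  proof -
    have "(cmod (a + b))\<^sup>2 \<le> (cmod a + cmod b)\<^sup>2"
      by (intro power_mono norm_triangle_ineq) auto
    also have "\<dots> \<le> 2 * (cmod a)\<^sup>2 + 2 * (cmod b)\<^sup>2"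
      using sum_squares_bound[of "cmod a" "cmod b"] by (simp add: power2_sum)
    finally show ?thesis .
  qed
  have "integrable \<mu> (\<lambda>x. 2 * (cmod (f x))\<^sup>2 + 2 * (cmod (g x))\<^sup>2)"
    using assms by (auto simp: L2_def)
  then have "integrable \<mu> (\<lambda>x. (cmod (f x + g x))\<^sup>2)"
    by (rule Bochner_Integration.integrable_bound) (use le in auto)
  then show ?thesis by (simp add: L2_def)
qed

lemma L2_diff:
  assumes "f \<in> L2 \<mu>" "g \<in> L2 \<mu>"
  shows "(\<lambda>x. f x - g x) \<in> L2 \<mu>"
  using L2_add[OF assms(1) L2_scale[OF assms(2), of "- 1"]] by simp

lemma L2_integrable_norm_mult:
  assumes "f \<in> L2 \<mu>" "g \<in> L2 \<mu>"
  shows "integrable \<mu> (\<lambda>x. cmod (f x) * cmod (g x))"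
proof -
  have [measurable]: "f \<in> borel_measurable \<mu>" "g \<in> borel_measurable \<mu>"
    using assms by (auto simp: L2_def)
  have le: "cmod a * cmod b \<le> (cmod a)\<^sup>2 + (cmod b)\<^sup>2" for a b
  proof -
    have "0 \<le> cmod a * cmod b" by simp
    with sum_squares_bound[of "cmod a" "cmod b"] show ?thesis by linarith
  qed
  have "integrable \<mu> (\<lambda>x. (cmod (f x))\<^sup>2 + (cmod (g x))\<^sup>2)"
    using assms by (auto simp: L2_def)
  then show ?thesis
    by (rule Bochner_Integration.integrable_bound) (use le in auto)
qed

lemma L2_integrable_cnj_mult:
  assumes "f \<in> L2 \<mu>" "g \<in> L2 \<mu>"
  shows "integrable \<mu> (\<lambda>x. cnj (f x) * g x)"
proof -
  have [measurable]: "f \<in> borel_measurable \<mu>" "g \<in> borel_measurable \<mu>"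
    using assms by (auto simp: L2_def)
  have "(\<lambda>x. cnj (f x)) \<in> borel_measurable \<mu>"
    by (intro borel_measurable_continuous_on[of cnj]) (auto intro: continuous_intros)
  then show ?thesis
    by (intro Bochner_Integration.integrable_bound[OF L2_integrable_norm_mult[OF assms]])
       (auto simp: norm_mult)
qed

lemma l2_inner_cong_AE:
  assumes "f \<in> borel_measurable \<mu>" "f' \<in> borel_measurable \<mu>" "AE x in \<mu>. f x = f' x"
    and "g \<in> borel_measurable \<mu>" "g' \<in> borel_measurable \<mu>" "AE x in \<mu>. g x = g' x"
  shows "l2_inner \<mu> f g = l2_inner \<mu> f' g'"
proof -
  have cnj: "(\<lambda>x. cnj (h x)) \<in> borel_measurable \<mu>" if "h \<in> borel_measurable \<mu>" for h
    using that by (intro borel_measurable_continuous_on[of cnj]) (auto intro: continuous_intros)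
  have "AE x in \<mu>. cnj (f x) * g x = cnj (f' x) * g' x"
    using assms(3,6) by eventually_elim simp
  then show ?thesis
    unfolding l2_inner_def
    by (intro integral_cong_AE borel_measurable_times cnj assms)
qed

lemma l2_norm_cong_AE:
  assumes "f \<in> borel_measurable \<mu>" "g \<in> borel_measurable \<mu>" "AE x in \<mu>. f x = g x"
  shows "l2_norm \<mu> f = l2_norm \<mu> g"
proof -
  have "(\<integral>x. (cmod (f x))\<^sup>2 \<partial>\<mu>) = (\<integral>x. (cmod (g x))\<^sup>2 \<partial>\<mu>)"
    by (rule integral_cong_AE) (use assms in auto)
  then show ?thesis by (simp add: l2_norm_def)
qed

lemma l2_norm_nonneg [simp]: "0 \<le> l2_norm \<mu> f"
  by (simp add: l2_norm_def)

lemma l2_norm_square: "(l2_norm \<mu> f)\<^sup>2 = (\<integral>x. (cmod (f x))\<^sup>2 \<partial>\<mu>)"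
  by (simp add: l2_norm_def)

lemma l2_norm_scale: "l2_norm \<mu> (\<lambda>x. c * f x) = cmod c * l2_norm \<mu> f"
  by (simp add: l2_norm_def norm_mult power_mult_distrib real_sqrt_mult)

lemma l2_inner_self: "l2_inner \<mu> f f = of_real ((l2_norm \<mu> f)\<^sup>2)"
proof -
  have "cnj (f x) * f x = complex_of_real ((cmod (f x))\<^sup>2)" for x
    by (metis complex_norm_square mult.commute)
  then show ?thesis by (simp add: l2_inner_def l2_norm_square del: of_real_power)
qed

lemma l2_inner_scale_left: "l2_inner \<mu> (\<lambda>x. c * f x) g = cnj c * l2_inner \<mu> f g"
  by (simp add: l2_inner_def mult.assoc)

lemma l2_inner_scale_right: "l2_inner \<mu> f (\<lambda>x. c * g x) = c * l2_inner \<mu> f g"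
  by (simp add: l2_inner_def mult.left_commute)

lemma l2_inner_diff_right:
  assumes "f \<in> L2 \<mu>" "g \<in> L2 \<mu>" "h \<in> L2 \<mu>"
  shows "l2_inner \<mu> f (\<lambda>x. g x - h x) = l2_inner \<mu> f g - l2_inner \<mu> f h"
  using L2_integrable_cnj_mult[OF assms(1,2)] L2_integrable_cnj_mult[OF assms(1,3)]
  by (simp add: l2_inner_def right_diff_distrib)

text \<open>Integrating \<open>(s \<bar>f\<bar> - \<bar>g\<bar>)\<^sup>2 \<ge> 0\<close> gives a quadratic polynomial in \<open>s\<close> without a
  sign change; its discriminant is the inequality.\<close>

lemma l2_integral_norm_mult_le:
  assumes "f \<in> L2 \<mu>" "g \<in> L2 \<mu>"
  shows "(\<integral>x. cmod (f x) * cmod (g x) \<partial>\<mu>) \<le> l2_norm \<mu> f * l2_norm \<mu> g"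
proof -
  define A B P where "A = (\<integral>x. (cmod (f x))\<^sup>2 \<partial>\<mu>)" and "B = (\<integral>x. (cmod (g x))\<^sup>2 \<partial>\<mu>)"
    and "P = (\<integral>x. cmod (f x) * cmod (g x) \<partial>\<mu>)"
  have [simp]: "0 \<le> A" "0 \<le> B"
    by (simp_all add: A_def B_def)
  have quad: "0 \<le> s\<^sup>2 * A - 2 * s * P + B" for s
  proof -
    have "0 \<le> (\<integral>x. (s * cmod (f x) - cmod (g x))\<^sup>2 \<partial>\<mu>)"
      by simp
    also have "\<dots> = (\<integral>x. s\<^sup>2 * (cmod (f x))\<^sup>2 - 2 * s * (cmod (f x) * cmod (g x)) + (cmod (g x))\<^sup>2 \<partial>\<mu>)"
      by (simp add: power2_diff power_mult_distrib algebra_simps)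
    also have "\<dots> = s\<^sup>2 * A - 2 * s * P + B"
      using L2_integrable_norm_mult[OF assms] L2_integrable_square[OF assms(1)]
        L2_integrable_square[OF assms(2)]
      by (simp add: A_def B_def P_def)
    finally show ?thesis .
  qed
  have "P\<^sup>2 \<le> A * B"
  proof (cases "A = 0")
    case True
    have "P = 0"
    proof (rule ccontr)
      assume "P \<noteq> 0"
      (* At this point the polynomial, linear when A = 0, takes the value - 1. *)
      with quad[of "(B + 1) / (2 * P)"] True show False
        by simp
    qed
    then show ?thesis by simp
  next
    case False
    then have "0 < A" using \<open>0 \<le> A\<close> by linarith
    (* P / A is the minimum of the parabola. *)
    with quad[of "P / A"] show ?thesis
      by (simp add: field_simps power2_eq_square)
  qed
  then have "P \<le> sqrt (A * B)"
    by (rule real_le_rsqrt)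
  then show ?thesis
    by (simp add: A_def B_def P_def l2_norm_def real_sqrt_mult)
qed

lemma l2_Cauchy_Schwarz:
  assumes "f \<in> L2 \<mu>" "g \<in> L2 \<mu>"
  shows "cmod (l2_inner \<mu> f g) \<le> l2_norm \<mu> f * l2_norm \<mu> g"
proof -
  have "cmod (l2_inner \<mu> f g) \<le> (\<integral>x. cmod (cnj (f x) * g x) \<partial>\<mu>)"
    unfolding l2_inner_def by (rule integral_norm_bound)
  also have "\<dots> = (\<integral>x. cmod (f x) * cmod (g x) \<partial>\<mu>)"
    by (simp add: norm_mult)
  also have "\<dots> \<le> l2_norm \<mu> f * l2_norm \<mu> g"
    by (rule l2_integral_norm_mult_le[OF assms])
  finally show ?thesis .
qed

lemma l2_norm_triangle:
  assumes "f \<in> L2 \<mu>" "g \<in> L2 \<mu>"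
  shows "l2_norm \<mu> (\<lambda>x. f x + g x) \<le> l2_norm \<mu> f + l2_norm \<mu> g"
proof -
  have int: "integrable \<mu> (\<lambda>x. (cmod (f x))\<^sup>2 + 2 * (cmod (f x) * cmod (g x)) + (cmod (g x))\<^sup>2)"
    using L2_integrable_norm_mult[OF assms] L2_integrable_square[OF assms(1)]
      L2_integrable_square[OF assms(2)] by simp
  have "(l2_norm \<mu> (\<lambda>x. f x + g x))\<^sup>2 = (\<integral>x. (cmod (f x + g x))\<^sup>2 \<partial>\<mu>)"
    by (rule l2_norm_square)
  also have "\<dots> \<le> (\<integral>x. (cmod (f x))\<^sup>2 + 2 * (cmod (f x) * cmod (g x)) + (cmod (g x))\<^sup>2 \<partial>\<mu>)"
  proof (rule integral_mono[OF L2_integrable_square[OF L2_add[OF assms]] int])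
    fix x
    have "(cmod (f x + g x))\<^sup>2 \<le> (cmod (f x) + cmod (g x))\<^sup>2"
      by (intro power_mono norm_triangle_ineq) auto
    then show "(cmod (f x + g x))\<^sup>2
        \<le> (cmod (f x))\<^sup>2 + 2 * (cmod (f x) * cmod (g x)) + (cmod (g x))\<^sup>2"
      by (simp add: power2_sum algebra_simps)
  qed
  also have "\<dots> = (l2_norm \<mu> f)\<^sup>2 + 2 * (\<integral>x. cmod (f x) * cmod (g x) \<partial>\<mu>) + (l2_norm \<mu> g)\<^sup>2"
    using L2_integrable_norm_mult[OF assms] L2_integrable_square[OF assms(1)]
      L2_integrable_square[OF assms(2)] by (simp add: l2_norm_square)
  also have "\<dots> \<le> (l2_norm \<mu> f + l2_norm \<mu> g)\<^sup>2"
    using l2_integral_norm_mult_le[OF assms] by (simp add: power2_sum)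
  finally show ?thesis
    by (rule power2_le_imp_le) simp
qed

lemma l2_norm_eq_0_imp_AE:
  assumes "f \<in> L2 \<mu>" "l2_norm \<mu> f = 0"
  shows "AE x in \<mu>. f x = 0"
proof -
  have "(\<integral>x. (cmod (f x))\<^sup>2 \<partial>\<mu>) = 0"
    using assms(2) by (simp add: l2_norm_def)
  then have "AE x in \<mu>. (cmod (f x))\<^sup>2 = 0"
    by (subst (asm) integral_nonneg_eq_0_iff_AE[OF L2_integrable_square[OF assms(1)]]) auto
  then show ?thesis by simp
qed

lemma L2_difference_quotient:
  assumes "c t \<in> L2 \<mu>" "c 0 \<in> L2 \<mu>" "D \<in> L2 \<mu>"
  shows "(\<lambda>x. (c t x - c 0 x) / of_real t - D x) \<in> L2 \<mu>"
  using L2_diff[OF L2_scale[OF L2_diff[OF assms(1,2)], of "1 / of_real t"] assms(3)]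
  by simp

section \<open>Differential calculus of curves of square-integrable functions\<close>

lemma has_l2_derivative_cong_AE:
  assumes der: "has_l2_derivative \<mu> c D"
    and c': "\<forall>\<^sub>F t in nhds 0. c' t \<in> borel_measurable \<mu> \<and> (AE x in \<mu>. c t x = c' t x)"
    and D': "D' \<in> borel_measurable \<mu>" "AE x in \<mu>. D x = D' x"
  shows "has_l2_derivative \<mu> c' D'"
proof -
  have c: "\<forall>\<^sub>F t in nhds 0. c t \<in> L2 \<mu>" and D: "D \<in> L2 \<mu>"
    and lim: "((\<lambda>t. l2_norm \<mu> (\<lambda>x. (c t x - c 0 x) / of_real t - D x)) \<longlongrightarrow> 0) (at 0)"
    using der by (auto simp: has_l2_derivative_def)
  have c0: "c 0 \<in> L2 \<mu>" "c' 0 \<in> borel_measurable \<mu>" "AE x in \<mu>. c 0 x = c' 0 x"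
    using eventually_nhds_x_imp_x[OF c] eventually_nhds_x_imp_x[OF c'] by auto
  have "D' \<in> L2 \<mu>"
    by (rule L2_cong_AE[OF D D'])
  moreover have "\<forall>\<^sub>F t in nhds 0. c' t \<in> L2 \<mu>"
    using c c' by eventually_elim (auto intro: L2_cong_AE)
  moreover have "((\<lambda>t. l2_norm \<mu> (\<lambda>x. (c' t x - c' 0 x) / of_real t - D' x)) \<longlongrightarrow> 0) (at 0)"
  proof (rule Lim_transform_eventually[OF lim])
    have "\<forall>\<^sub>F t in nhds 0. l2_norm \<mu> (\<lambda>x. (c t x - c 0 x) / of_real t - D x)
        = l2_norm \<mu> (\<lambda>x. (c' t x - c' 0 x) / of_real t - D' x)"
      using c c'
    proof eventually_elim
      case (elim t)
      then have ae: "AE x in \<mu>. c t x = c' t x" by simp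
      show ?case
      proof (rule l2_norm_cong_AE)
        show "(\<lambda>x. (c t x - c 0 x) / of_real t - D x) \<in> borel_measurable \<mu>"
          by (rule L2_measurable[OF L2_difference_quotient]) (use elim c0 D in auto)
        show "(\<lambda>x. (c' t x - c' 0 x) / of_real t - D' x) \<in> borel_measurable \<mu>"
          by (intro borel_measurable_diff borel_measurable_divide borel_measurable_const)
             (use elim c0 D' in auto)
        show "AE x in \<mu>. (c t x - c 0 x) / of_real t - D x
            = (c' t x - c' 0 x) / of_real t - D' x"
          using ae c0(3) D'(2) by eventually_elim simp
      qed
    qed
    then show "\<forall>\<^sub>F t in at 0. l2_norm \<mu> (\<lambda>x. (c t x - c 0 x) / of_real t - D x)
        = l2_norm \<mu> (\<lambda>x. (c' t x - c' 0 x) / of_real t - D' x)"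
      by (auto simp: eventually_at_filter elim: eventually_mono)
  qed
  ultimately show ?thesis
    by (simp add: has_l2_derivative_def)
qed

lemma has_l2_derivative_unique:
  assumes "has_l2_derivative \<mu> c D" "has_l2_derivative \<mu> c D'"
  shows "AE x in \<mu>. D x = D' x"
proof -
  have c: "\<forall>\<^sub>F t in nhds 0. c t \<in> L2 \<mu>" and D: "D \<in> L2 \<mu>" "D' \<in> L2 \<mu>"
    and lim: "((\<lambda>t. l2_norm \<mu> (\<lambda>x. (c t x - c 0 x) / of_real t - D x)) \<longlongrightarrow> 0) (at 0)"
    and lim': "((\<lambda>t. l2_norm \<mu> (\<lambda>x. (c t x - c 0 x) / of_real t - D' x)) \<longlongrightarrow> 0) (at 0)"
    using assms by (auto simp: has_l2_derivative_def)
  have c0: "c 0 \<in> L2 \<mu>"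
    by (rule eventually_nhds_x_imp_x[OF c])
  have bound: "\<forall>\<^sub>F t in at 0. l2_norm \<mu> (\<lambda>x. D x - D' x)
      \<le> l2_norm \<mu> (\<lambda>x. (c t x - c 0 x) / of_real t - D' x)
        + l2_norm \<mu> (\<lambda>x. (c t x - c 0 x) / of_real t - D x)"
    using c[unfolded eventually_nhds_conv_at, THEN conjunct1]
  proof eventually_elim
    case (elim t)
    have "l2_norm \<mu> (\<lambda>x. D x - D' x) = l2_norm \<mu> (\<lambda>x. ((c t x - c 0 x) / of_real t - D' x)
        + (- 1) * ((c t x - c 0 x) / of_real t - D x))"
      by simp
    also have "\<dots> \<le> l2_norm \<mu> (\<lambda>x. (c t x - c 0 x) / of_real t - D' x)
        + l2_norm \<mu> (\<lambda>x. (- 1) * ((c t x - c 0 x) / of_real t - D x))"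
      by (intro l2_norm_triangle L2_scale L2_difference_quotient elim c0 D)
    finally show ?case unfolding l2_norm_scale by simp
  qed
  have "l2_norm \<mu> (\<lambda>x. D x - D' x) \<le> 0"
    by (rule tendsto_lowerbound[OF _ bound]) (use tendsto_add[OF lim' lim] in auto)
  then have "l2_norm \<mu> (\<lambda>x. D x - D' x) = 0"
    using l2_norm_nonneg[of \<mu> "\<lambda>x. D x - D' x"] by linarith
  from l2_norm_eq_0_imp_AE[OF L2_diff[OF D] this] show ?thesis
    by simp
qed

lemma l2_velocity_AE:
  assumes "has_l2_derivative \<mu> c D"
  shows "l2_velocity \<mu> c \<in> borel_measurable \<mu>" "AE x in \<mu>. l2_velocity \<mu> c x = D x"
proof -
  have "has_l2_derivative \<mu> c (l2_velocity \<mu> c)"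
    unfolding l2_velocity_def by (rule someI[of "has_l2_derivative \<mu> c", OF assms])
  then show "l2_velocity \<mu> c \<in> borel_measurable \<mu>" "AE x in \<mu>. l2_velocity \<mu> c x = D x"
    using has_l2_derivative_unique[OF _ assms] by (auto simp: has_l2_derivative_def L2_def)
qed

lemma has_l2_derivative_diff_const:
  assumes "has_l2_derivative \<mu> c D" "w \<in> L2 \<mu>"
  shows "has_l2_derivative \<mu> (\<lambda>t x. c t x - w x) D"
  using assms unfolding has_l2_derivative_def
  by (auto intro: L2_diff elim: eventually_mono)

lemma l2_inner_has_vector_derivative:
  assumes der: "has_l2_derivative \<mu> c D" and w: "w \<in> L2 \<mu>"
  shows "((\<lambda>t. l2_inner \<mu> w (c t)) has_vector_derivative l2_inner \<mu> w D) (at 0)"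
proof -
  have c: "\<forall>\<^sub>F t in nhds 0. c t \<in> L2 \<mu>" and D: "D \<in> L2 \<mu>"
    and lim: "((\<lambda>t. l2_norm \<mu> (\<lambda>x. (c t x - c 0 x) / of_real t - D x)) \<longlongrightarrow> 0) (at 0)"
    using der by (auto simp: has_l2_derivative_def)
  have c0: "c 0 \<in> L2 \<mu>"
    by (rule eventually_nhds_x_imp_x[OF c])
  have "((\<lambda>t. (l2_inner \<mu> w (c t) - l2_inner \<mu> w (c 0)) / of_real t - l2_inner \<mu> w D) \<longlongrightarrow> 0) (at 0)"
  proof (rule Lim_null_comparison)
    show "\<forall>\<^sub>F t in at 0. norm ((l2_inner \<mu> w (c t) - l2_inner \<mu> w (c 0)) / of_real t - l2_inner \<mu> w D)
        \<le> l2_norm \<mu> w * l2_norm \<mu> (\<lambda>x. (c t x - c 0 x) / of_real t - D x)"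
      using c[unfolded eventually_nhds_conv_at, THEN conjunct1]
    proof eventually_elim
      case (elim t)
      have "l2_inner \<mu> w (\<lambda>x. (c t x - c 0 x) / of_real t - D x)
          = l2_inner \<mu> w (\<lambda>x. (1 / of_real t) * (c t x - c 0 x)) - l2_inner \<mu> w D"
        using l2_inner_diff_right[OF w L2_scale[OF L2_diff[OF elim c0], of "1 / of_real t"] D]
        by simp
      also have "\<dots> = (l2_inner \<mu> w (c t) - l2_inner \<mu> w (c 0)) / of_real t - l2_inner \<mu> w D"
        by (simp only: l2_inner_scale_right l2_inner_diff_right[OF w elim c0])
           (simp add: field_simps)
      finally show ?case
        using l2_Cauchy_Schwarz[OF w L2_difference_quotient[of c t \<mu> D, OF elim c0 D]] by simp
    qed
    show "((\<lambda>t. l2_norm \<mu> w * l2_norm \<mu> (\<lambda>x. (c t x - c 0 x) / of_real t - D x)) \<longlongrightarrow> 0) (at 0)"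
      using tendsto_mult_right_zero[OF lim] by simp
  qed
  then have "((\<lambda>t. (l2_inner \<mu> w (c t) - l2_inner \<mu> w (c 0)) / of_real t) \<longlongrightarrow> l2_inner \<mu> w D) (at 0)"
    by (simp add: LIM_zero_iff)
  then show ?thesis
    by (simp add: has_vector_derivative_at_0_iff_quotient)
qed

lemma has_l2_derivative_scale:
  assumes der: "has_l2_derivative \<mu> c D"
    and r: "(r has_vector_derivative r') (at 0)"
  shows "has_l2_derivative \<mu> (\<lambda>t x. r t * c t x) (\<lambda>x. r 0 * D x + r' * c 0 x)"
proof -
  have c: "\<forall>\<^sub>F t in nhds 0. c t \<in> L2 \<mu>" and D: "D \<in> L2 \<mu>"
    and lim: "((\<lambda>t. l2_norm \<mu> (\<lambda>x. (c t x - c 0 x) / of_real t - D x)) \<longlongrightarrow> 0) (at 0)"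
    using der by (auto simp: has_l2_derivative_def)
  have c0: "c 0 \<in> L2 \<mu>"
    by (rule eventually_nhds_x_imp_x[OF c])
  have rlim: "(r \<longlongrightarrow> r 0) (at 0)"
    using has_vector_derivative_continuous[OF r] by (simp add: continuous_at)
  have rdiff: "((\<lambda>t. (r t - r 0) / of_real t) \<longlongrightarrow> r') (at 0)"
    using r by (simp add: has_vector_derivative_at_0_iff_quotient)
  have "((\<lambda>t. l2_norm \<mu> (\<lambda>x. (r t * c t x - r 0 * c 0 x) / of_real t
      - (r 0 * D x + r' * c 0 x))) \<longlongrightarrow> 0) (at 0)"
  proof (rule Lim_null_comparison)
    show "\<forall>\<^sub>F t in at 0. norm (l2_norm \<mu> (\<lambda>x. (r t * c t x - r 0 * c 0 x) / of_real t
        - (r 0 * D x + r' * c 0 x)))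
      \<le> cmod (r t) * l2_norm \<mu> (\<lambda>x. (c t x - c 0 x) / of_real t - D x)
        + (cmod (r t - r 0) * l2_norm \<mu> D
           + cmod ((r t - r 0) / of_real t - r') * l2_norm \<mu> (c 0))"
      using c[unfolded eventually_nhds_conv_at, THEN conjunct1]
    proof eventually_elim
      case (elim t)
      have split: "(r t * c t x - r 0 * c 0 x) / of_real t - (r 0 * D x + r' * c 0 x)
          = r t * ((c t x - c 0 x) / of_real t - D x)
            + ((r t - r 0) * D x + ((r t - r 0) / of_real t - r') * c 0 x)" for x
        by (simp add: diff_divide_distrib algebra_simps)
      have "l2_norm \<mu> (\<lambda>x. r t * ((c t x - c 0 x) / of_real t - D x)
            + ((r t - r 0) * D x + ((r t - r 0) / of_real t - r') * c 0 x))
          \<le> l2_norm \<mu> (\<lambda>x. r t * ((c t x - c 0 x) / of_real t - D x))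
            + l2_norm \<mu> (\<lambda>x. (r t - r 0) * D x + ((r t - r 0) / of_real t - r') * c 0 x)"
        by (intro l2_norm_triangle L2_add L2_scale L2_difference_quotient elim c0 D)
      also have "l2_norm \<mu> (\<lambda>x. (r t - r 0) * D x + ((r t - r 0) / of_real t - r') * c 0 x)
          \<le> l2_norm \<mu> (\<lambda>x. (r t - r 0) * D x)
            + l2_norm \<mu> (\<lambda>x. ((r t - r 0) / of_real t - r') * c 0 x)"
        by (intro l2_norm_triangle L2_scale c0 D)
      finally show ?case
        unfolding split l2_norm_scale by simp
    qed
    show "((\<lambda>t. cmod (r t) * l2_norm \<mu> (\<lambda>x. (c t x - c 0 x) / of_real t - D x)
        + (cmod (r t - r 0) * l2_norm \<mu> D
           + cmod ((r t - r 0) / of_real t - r') * l2_norm \<mu> (c 0))) \<longlongrightarrow> 0) (at 0)"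
    proof -
      have "((\<lambda>t. cmod (r t) * l2_norm \<mu> (\<lambda>x. (c t x - c 0 x) / of_real t - D x)
        + (cmod (r t - r 0) * l2_norm \<mu> D
           + cmod ((r t - r 0) / of_real t - r') * l2_norm \<mu> (c 0)))
        \<longlongrightarrow> cmod (r 0) * 0 + (cmod (r 0 - r 0) * l2_norm \<mu> D + cmod (r' - r') * l2_norm \<mu> (c 0))) (at 0)"
        by (intro tendsto_intros rlim rdiff lim)
      then show ?thesis by simp
    qed
  qed
  moreover have "\<forall>\<^sub>F t in nhds 0. (\<lambda>x. r t * c t x) \<in> L2 \<mu>"
    using c by eventually_elim (rule L2_scale)
  moreover have "(\<lambda>x. r 0 * D x + r' * c 0 x) \<in> L2 \<mu>"
    by (intro L2_add L2_scale c0 D)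
  ultimately show ?thesis
    by (simp add: has_l2_derivative_def)
qed

section \<open>Curves in projective space\<close>

lemma proj_self: "z \<in> L2 \<mu> \<Longrightarrow> z \<in> proj \<mu> z"
  unfolding proj_def by (auto intro!: exI[of _ 1])

lemma l2_inner_proj_member:
  assumes "z\<^sub>0 \<in> L2 \<mu>" "z \<in> L2 \<mu>" "w \<in> L2 \<mu>" "AE x in \<mu>. w x = k * z x"
  shows "l2_inner \<mu> z\<^sub>0 w = k * l2_inner \<mu> z\<^sub>0 z"
proof -
  have "l2_inner \<mu> z\<^sub>0 w = l2_inner \<mu> z\<^sub>0 (\<lambda>x. k * z x)"
    by (rule l2_inner_cong_AE) (use assms in \<open>auto intro: L2_measurable L2_scale\<close>)
  then show ?thesis by (simp add: l2_inner_scale_right)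
qed

lemma unit_representative_phase:
  assumes "z \<in> l2_sphere \<mu>" "z\<^sub>0 \<in> proj \<mu> z \<inter> l2_sphere \<mu>"
  obtains k where "cmod k = 1" "AE x in \<mu>. z\<^sub>0 x = k * z x"
proof -
  obtain k where k: "AE x in \<mu>. z\<^sub>0 x = k * z x"
    using assms(2) by (auto simp: proj_def)
  have L2: "z \<in> L2 \<mu>" "z\<^sub>0 \<in> L2 \<mu>" and norm: "l2_norm \<mu> z = 1" "l2_norm \<mu> z\<^sub>0 = 1"
    using assms by (auto simp: l2_sphere_def)
  have "l2_norm \<mu> z\<^sub>0 = l2_norm \<mu> (\<lambda>x. k * z x)"
    by (rule l2_norm_cong_AE) (use L2 k in \<open>auto intro: L2_measurable L2_scale\<close>)
  then have "cmod k = 1"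
    using norm by (simp add: l2_norm_scale)
  then show thesis using k by (rule that)
qed

text \<open>The quotient defining the chart is homogeneous of degree zero, so any representative may be
  used to compute it.\<close>

lemma fs_chart_proj_AE:
  assumes "z\<^sub>0 \<in> L2 \<mu>" "z \<in> L2 \<mu>"
  shows "fs_chart \<mu> z\<^sub>0 (proj \<mu> z) \<in> borel_measurable \<mu>"
    and "AE x in \<mu>. fs_chart \<mu> z\<^sub>0 (proj \<mu> z) x = z x / l2_inner \<mu> z\<^sub>0 z - z\<^sub>0 x"
proof -
  define w where "w = (SOME w. w \<in> proj \<mu> z)"
  have "w \<in> proj \<mu> z"
    unfolding w_def by (rule someI[of "\<lambda>w. w \<in> proj \<mu> z", OF proj_self[OF assms(2)]])
  then obtain k where k: "k \<noteq> 0" "AE x in \<mu>. w x = k * z x" and w: "w \<in> L2 \<mu>"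
    by (auto simp: proj_def)
  have chart: "fs_chart \<mu> z\<^sub>0 (proj \<mu> z) = (\<lambda>x. w x / l2_inner \<mu> z\<^sub>0 w - z\<^sub>0 x)"
    by (simp add: fs_chart_def Let_def w_def)
  show "fs_chart \<mu> z\<^sub>0 (proj \<mu> z) \<in> borel_measurable \<mu>"
    unfolding chart using w assms by (intro borel_measurable_diff borel_measurable_divide
        borel_measurable_const L2_measurable)
  show "AE x in \<mu>. fs_chart \<mu> z\<^sub>0 (proj \<mu> z) x = z x / l2_inner \<mu> z\<^sub>0 z - z\<^sub>0 x"
    unfolding chart l2_inner_proj_member[OF assms w k(2)]
    using k(2) by eventually_elim (use k(1) in simp)
qed

lemma proj_in_fs_chart_domain:
  assumes "z\<^sub>0 \<in> L2 \<mu>" "z \<in> L2 \<mu>" "l2_inner \<mu> z\<^sub>0 z \<noteq> 0"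
  shows "proj \<mu> z \<in> fs_chart_domain \<mu> z\<^sub>0"
proof -
  have "l2_norm \<mu> z \<noteq> 0"
    using l2_Cauchy_Schwarz[OF assms(1,2)] assms(3) by auto
  moreover have "l2_inner \<mu> z\<^sub>0 w \<noteq> 0" if "w \<in> proj \<mu> z" for w
    using that assms l2_inner_proj_member[OF assms(1,2)] by (auto simp: proj_def)
  ultimately show ?thesis
    using assms(2) by (auto simp: fs_chart_domain_def proj_space_def)
qed

text \<open>In the chart the curve is \<open>z\<^sub>t / \<langle>z\<^sub>0, z\<^sub>t\<rangle> - z\<^sub>0\<close>, so the product rule applies.
  Dividing by \<open>\<langle>z\<^sub>0, z\<^sub>t\<rangle>\<close> removes from the velocity its component along the starting point.\<close>

lemma fs_chart_curve:
  assumes der: "has_l2_derivative \<mu> c D" and c0: "c 0 \<in> l2_sphere \<mu>"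
    and z0: "z\<^sub>0 \<in> L2 \<mu>" and k: "cmod k = 1" "AE x in \<mu>. z\<^sub>0 x = k * c 0 x"
  shows "\<forall>\<^sub>F t in nhds 0. proj \<mu> (c t) \<in> fs_chart_domain \<mu> z\<^sub>0"
    and "has_l2_derivative \<mu> (\<lambda>t. fs_chart \<mu> z\<^sub>0 (proj \<mu> (c t)))
      (\<lambda>x. k * (D x - l2_inner \<mu> (c 0) D * c 0 x))"
proof -
  have c: "\<forall>\<^sub>F t in nhds 0. c t \<in> L2 \<mu>" and D: "D \<in> L2 \<mu>"
    using der by (auto simp: has_l2_derivative_def)
  have c0L2: "c 0 \<in> L2 \<mu>" and norm: "l2_norm \<mu> (c 0) = 1"
    using c0 by (auto simp: l2_sphere_def)
  have kk: "k * cnj k = 1"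
    using k(1) by (simp add: complex_norm_square[symmetric])
  have inner: "l2_inner \<mu> z\<^sub>0 h = cnj k * l2_inner \<mu> (c 0) h" if "h \<in> L2 \<mu>" for h
  proof -
    have "l2_inner \<mu> z\<^sub>0 h = l2_inner \<mu> (\<lambda>x. k * c 0 x) h"
      by (rule l2_inner_cong_AE) (use z0 k that c0L2 in \<open>auto intro: L2_measurable L2_scale\<close>)
    then show ?thesis by (simp add: l2_inner_scale_left)
  qed
  define s where "s t = l2_inner \<mu> (c 0) (c t)" for t
  define s' where "s' = l2_inner \<mu> (c 0) D"
  have s0: "s 0 = 1"
    by (simp add: s_def l2_inner_self norm)
  have s': "(s has_vector_derivative s') (at 0)"
    unfolding s_def s'_def by (rule l2_inner_has_vector_derivative[OF der c0L2])
  have "(s \<longlongrightarrow> s 0) (nhds 0)"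
    using has_vector_derivative_continuous[OF s'] by (simp add: continuous_at tendsto_at_iff_tendsto_nhds)
  then have s_nz: "\<forall>\<^sub>F t in nhds 0. s t \<noteq> 0"
    by (rule tendsto_imp_eventually_ne) (simp add: s0)
  show "\<forall>\<^sub>F t in nhds 0. proj \<mu> (c t) \<in> fs_chart_domain \<mu> z\<^sub>0"
    using c s_nz
  proof eventually_elim
    case (elim t)
    then show ?case
      using kk by (intro proj_in_fs_chart_domain z0) (auto simp: inner s_def)
  qed
  have r': "((\<lambda>t. k / s t) has_vector_derivative - (k * s')) (at 0)"
  proof -
    have "((\<lambda>w. k / w) has_field_derivative - k) (at (s 0))"
      unfolding s0 by (auto intro!: derivative_eq_intros)
    from field_vector_diff_chain_at[OF s' this] show ?thesis
      by (simp add: o_def mult.commute)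
  qed
  have "has_l2_derivative \<mu> (\<lambda>t x. k / s t * c t x - z\<^sub>0 x)
      (\<lambda>x. k / s 0 * D x + - (k * s') * c 0 x)"
    by (intro has_l2_derivative_diff_const has_l2_derivative_scale[OF der r'] z0)
  then show "has_l2_derivative \<mu> (\<lambda>t. fs_chart \<mu> z\<^sub>0 (proj \<mu> (c t)))
      (\<lambda>x. k * (D x - l2_inner \<mu> (c 0) D * c 0 x))"
  proof (rule has_l2_derivative_cong_AE)
    show "(\<lambda>x. k * (D x - l2_inner \<mu> (c 0) D * c 0 x)) \<in> borel_measurable \<mu>"
      by (intro L2_measurable[OF L2_scale] L2_diff L2_scale D c0L2)
    show "AE x in \<mu>. k / s 0 * D x + - (k * s') * c 0 x = k * (D x - l2_inner \<mu> (c 0) D * c 0 x)"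
      by (simp add: s0 s'_def algebra_simps)
    show "\<forall>\<^sub>F t in nhds 0. fs_chart \<mu> z\<^sub>0 (proj \<mu> (c t)) \<in> borel_measurable \<mu> \<and>
        (AE x in \<mu>. k / s t * c t x - z\<^sub>0 x = fs_chart \<mu> z\<^sub>0 (proj \<mu> (c t)) x)"
      using c
    proof eventually_elim
      case (elim t)
      have "k / s t = 1 / l2_inner \<mu> z\<^sub>0 (c t)"
        using inverse_unique[of "cnj k" k] kk
        by (simp add: inner[OF elim] s_def[symmetric] divide_inverse mult.commute)
      with fs_chart_proj_AE[OF z0 elim] show ?case
        by (auto elim!: eventually_mono)
    qed
  qed
qed

lemma proj_differentiable_curve:
  assumes "has_l2_derivative \<mu> c D" "c 0 \<in> l2_sphere \<mu>"
  shows "proj_differentiable \<mu> (\<lambda>t. proj \<mu> (c t))"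
  unfolding proj_differentiable_def
proof (intro conjI ballI)
  show "proj \<mu> (c 0) \<in> proj_space \<mu>"
    using assms(2) by (auto simp: proj_space_def l2_sphere_def)
next
  fix z\<^sub>0 assume z0: "z\<^sub>0 \<in> proj \<mu> (c 0) \<inter> l2_sphere \<mu>"
  obtain k where k: "cmod k = 1" "AE x in \<mu>. z\<^sub>0 x = k * c 0 x"
    using unit_representative_phase[OF assms(2) z0] .
  have "z\<^sub>0 \<in> L2 \<mu>" using z0 by (simp add: l2_sphere_def)
  note curve = fs_chart_curve[OF assms this k]
  show "\<forall>\<^sub>F t in nhds 0. proj \<mu> (c t) \<in> fs_chart_domain \<mu> z\<^sub>0"
    by (rule curve)
  show "\<exists>D. has_l2_derivative \<mu> (\<lambda>t. fs_chart \<mu> z\<^sub>0 (proj \<mu> (c t))) D"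
    using curve(2) by blast
qed

text \<open>The unit representative chosen by \<open>fubini_study\<close> is \<open>k z\<close> with \<open>\<bar>k\<bar> = 1\<close>.  Both chart
  velocities carry the factor \<open>k\<close>, and \<open>cnj k * k = 1\<close>.\<close>

lemma fubini_study_curves:
  assumes c1: "has_l2_derivative \<mu> c1 D1" and c2: "has_l2_derivative \<mu> c2 D2"
    and z: "c1 0 = z" "c2 0 = z" "z \<in> l2_sphere \<mu>"
  shows "fubini_study \<mu> (\<lambda>t. proj \<mu> (c1 t)) (\<lambda>t. proj \<mu> (c2 t))
    = l2_inner \<mu> (\<lambda>x. D1 x - l2_inner \<mu> z D1 * z x) (\<lambda>x. D2 x - l2_inner \<mu> z D2 * z x)"
proof -
  define z\<^sub>0 where "z\<^sub>0 = (SOME w. w \<in> proj \<mu> z \<inter> l2_sphere \<mu>)"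
  have zL2: "z \<in> L2 \<mu>" using z by (simp add: l2_sphere_def)
  have "z \<in> proj \<mu> z \<inter> l2_sphere \<mu>"
    using proj_self[OF zL2] z(3) by simp
  then have z0: "z\<^sub>0 \<in> proj \<mu> z \<inter> l2_sphere \<mu>"
    unfolding z\<^sub>0_def by (rule someI[of "\<lambda>w. w \<in> proj \<mu> z \<inter> l2_sphere \<mu>"])
  obtain k where k: "cmod k = 1" "AE x in \<mu>. z\<^sub>0 x = k * z x"
    using unit_representative_phase[OF z(3) z0] .
  have z0L2: "z\<^sub>0 \<in> L2 \<mu>" using z0 by (simp add: l2_sphere_def)
  have D: "D1 \<in> L2 \<mu>" "D2 \<in> L2 \<mu>"
    using c1 c2 by (auto simp: has_l2_derivative_def)
  note v1 = l2_velocity_AE[OF fs_chart_curve(2)[OF c1 _ z0L2 k(1), unfolded z(1), OF z(3) k(2)]]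
  note v2 = l2_velocity_AE[OF fs_chart_curve(2)[OF c2 _ z0L2 k(1), unfolded z(2), OF z(3) k(2)]]
  have "fubini_study \<mu> (\<lambda>t. proj \<mu> (c1 t)) (\<lambda>t. proj \<mu> (c2 t))
      = l2_inner \<mu> (l2_velocity \<mu> (\<lambda>t. fs_chart \<mu> z\<^sub>0 (proj \<mu> (c1 t))))
                   (l2_velocity \<mu> (\<lambda>t. fs_chart \<mu> z\<^sub>0 (proj \<mu> (c2 t))))"
    by (simp add: fubini_study_def Let_def z z\<^sub>0_def)
  also have "\<dots> = l2_inner \<mu> (\<lambda>x. k * (D1 x - l2_inner \<mu> z D1 * z x))
      (\<lambda>x. k * (D2 x - l2_inner \<mu> z D2 * z x))"
    by (intro l2_inner_cong_AE v1 v2 L2_measurable[OF L2_scale] L2_diff L2_scale D zL2)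
  also have "\<dots> = (cnj k * k) * l2_inner \<mu> (\<lambda>x. D1 x - l2_inner \<mu> z D1 * z x)
      (\<lambda>x. D2 x - l2_inner \<mu> z D2 * z x)"
    by (simp add: l2_inner_scale_left l2_inner_scale_right)
  also have "cnj k * k = 1"
    using k(1) by (simp add: complex_norm_square[symmetric] mult.commute)
  finally show ?thesis by simp
qed

section \<open>Exponential families in natural coordinates\<close>

locale regular_exponential_family =
  fixes \<mu> :: "'x measure" and E :: "(real^'n::finite) set"
    and C :: "'x \<Rightarrow> real" and F :: "'n \<Rightarrow> 'x \<Rightarrow> real"
  assumes exponential_family: "exponential_family \<mu> E C F"
    and under_integral: "differentiates_under_integral \<mu> E C F"
    and Phi_Gateaux: "Phi_Gateaux_differentiable \<mu> E C F"
begin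

abbreviation dens :: "real^'n \<Rightarrow> 'x \<Rightarrow> real" where
  "dens \<equiv> ef_density \<mu> C F"

abbreviation potential :: "real^'n \<Rightarrow> real" where
  "potential \<equiv> log_partition \<mu> C F"

definition statistic :: "'x \<Rightarrow> real^'n" where
  "statistic x = (\<chi> k. F k x)"

definition mean :: "real^'n \<Rightarrow> real^'n" where
  "mean \<theta> = (\<chi> k. \<integral>x. F k x * dens \<theta> x \<partial>\<mu>)"

definition score :: "real^'n \<Rightarrow> real^'n \<Rightarrow> 'x \<Rightarrow> real" where
  "score \<theta> v x = v \<bullet> (statistic x - mean \<theta>)"

lemma inner_statistic: "v \<bullet> statistic x = (\<Sum>k\<in>UNIV. v $ k * F k x)"
  by (simp add: statistic_def inner_vec_def)

lemma inner_statistic_measurable [measurable]: "(\<lambda>x. v \<bullet> statistic x) \<in> borel_measurable \<mu>"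
  unfolding inner_statistic using exponential_family
  by (intro borel_measurable_sum borel_measurable_times borel_measurable_const)
    (auto simp: exponential_family_def)

lemma score_measurable [measurable]: "score \<theta> v \<in> borel_measurable \<mu>"
  unfolding score_def inner_diff_right by measurable

lemma density_eq: "dens \<theta> x = exp (C x + \<theta> \<bullet> statistic x - potential \<theta>)"
  by (simp add: ef_density_def inner_statistic)

lemma density_pos [simp]: "0 < dens \<theta> x"
  by (simp add: ef_density_def)

lemma density_nonzero [simp]: "dens \<theta> x \<noteq> 0"
  using density_pos[of \<theta> x] by linarith

lemma density_measurable [measurable]: "dens \<theta> \<in> borel_measurable \<mu>"
proof -
  have [measurable]: "C \<in> borel_measurable \<mu>"
    using exponential_family by (simp add: exponential_family_def)
  show ?thesis unfolding density_eq[abs_def] by measurable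
qed

lemma density_integral:
  assumes "\<theta> \<in> E"
  shows "integrable \<mu> (dens \<theta>)" "(\<integral>x. dens \<theta> x \<partial>\<mu>) = 1"
proof -
  define G where "G x = exp (C x + (\<Sum>k\<in>UNIV. \<theta> $ k * F k x))" for x
  have G: "integrable \<mu> G" "0 < integral\<^sup>L \<mu> G"
    using exponential_family assms by (auto simp: exponential_family_def G_def[abs_def])
  have "dens \<theta> = (\<lambda>x. G x / integral\<^sup>L \<mu> G)"
    using G(2) by (auto simp: ef_density_def log_partition_def G_def[abs_def] exp_diff)
  then show "integrable \<mu> (dens \<theta>)" "(\<integral>x. dens \<theta> x \<partial>\<mu>) = 1"
    using G by simp_all
qed

lemma not_AE_False:
  assumes "\<theta> \<in> E" shows "\<not> (AE x in \<mu>. False)"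
proof
  assume "AE x in \<mu>. False"
  then have "AE x in \<mu>. dens \<theta> x = 0"
    by (rule eventually_mono) simp
  then have "(\<integral>x. dens \<theta> x \<partial>\<mu>) = 0"
    by (rule integral_eq_zero_AE)
  with density_integral(2)[OF assms] show False by simp
qed

lemma line_in_domain:
  assumes "\<theta> \<in> E" shows "\<forall>\<^sub>F t in nhds 0. \<theta> + t *\<^sub>R v \<in> E"
proof -
  have "((\<lambda>t. \<theta> + t *\<^sub>R v) \<longlongrightarrow> \<theta> + 0 *\<^sub>R v) (nhds 0)"
    by (intro tendsto_intros filterlim_ident)
  then show ?thesis
    by (rule topological_tendstoD) (use assms exponential_family in \<open>auto simp: exponential_family_def\<close>)
qed

lemma line_smooth:
  assumes "\<theta> \<in> E" shows "smooth_curve_at_0 E (\<lambda>t. \<theta> + t *\<^sub>R v)"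
proof -
  obtain \<epsilon> where \<epsilon>: "\<epsilon> > 0" "\<And>t. dist t 0 < \<epsilon> \<Longrightarrow> \<theta> + t *\<^sub>R v \<in> E"
    using line_in_domain[OF assms] unfolding eventually_nhds_metric by blast
  define D where "D n t = (if n = 0 then \<theta> + t *\<^sub>R v else if n = 1 then v else 0)" for n :: nat and t :: real
  have "(D n has_vector_derivative D (Suc n) t) (at t)" for n t
    by (cases n) (auto simp: D_def[abs_def] intro!: derivative_eq_intros)
  then show ?thesis
    unfolding smooth_curve_at_0_def using \<epsilon>
    by (intro exI[of _ \<epsilon>] conjI exI[of _ D]) (auto simp: D_def[abs_def])
qed

text \<open>The potential is differentiable because \<open>ln p\<^sub>\<theta>(x)\<close> is, at any one sample point, and differs
  from it by an affine function of \<open>\<theta>\<close>.  The value of the derivative comes from differentiating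
  \<open>\<integral>p\<^sub>\<theta> d\<mu> = 1\<close>.\<close>

lemma potential_line_derivative_aux:
  assumes "\<theta> \<in> E"
  obtains d where "((\<lambda>t. potential (\<theta> + t *\<^sub>R v)) has_real_derivative d) (at 0)"
    "integrable \<mu> (\<lambda>x. v \<bullet> statistic x * dens \<theta> x)"
    "(\<integral>x. v \<bullet> statistic x * dens \<theta> x \<partial>\<mu>) = d"
proof -
  have diff: "\<And>x. x \<in> space \<mu> \<Longrightarrow> (\<lambda>t. dens (\<theta> + t *\<^sub>R v) x) field_differentiable (at 0)"
    and int: "integrable \<mu> (\<lambda>x. deriv (\<lambda>t. dens (\<theta> + t *\<^sub>R v) x) 0)"
    and der: "((\<lambda>t. \<integral>x. dens (\<theta> + t *\<^sub>R v) x \<partial>\<mu>) has_real_derivative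
          (\<integral>x. deriv (\<lambda>t. dens (\<theta> + t *\<^sub>R v) x) 0 \<partial>\<mu>)) (at 0)"
    using under_integral line_smooth[OF assms, of v]
    by (auto simp: differentiates_under_integral_def)
  obtain x where x: "x \<in> space \<mu>"
    using not_AE_False[OF assms] by (metis AE_I2)
  obtain p' where p': "((\<lambda>t. dens (\<theta> + t *\<^sub>R v) x) has_real_derivative p') (at 0)"
    using diff[OF x] by (auto simp: field_differentiable_def)
  define d where "d = v \<bullet> statistic x - p' / dens \<theta> x"
  have pot: "potential (\<theta> + t *\<^sub>R v)
      = C x + (\<theta> \<bullet> statistic x + t * (v \<bullet> statistic x)) - ln (dens (\<theta> + t *\<^sub>R v) x)" for t
    by (simp add: density_eq inner_add_left)
  have d: "((\<lambda>t. potential (\<theta> + t *\<^sub>R v)) has_real_derivative d) (at 0)"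
    unfolding pot d_def by (auto intro!: derivative_eq_intros p')
  have deriv: "deriv (\<lambda>t. dens (\<theta> + t *\<^sub>R v) y) 0
      = v \<bullet> statistic y * dens \<theta> y - d * dens \<theta> y" for y
  proof (rule DERIV_imp_deriv)
    show "((\<lambda>t. dens (\<theta> + t *\<^sub>R v) y) has_real_derivative
        v \<bullet> statistic y * dens \<theta> y - d * dens \<theta> y) (at 0)"
      unfolding density_eq inner_add_left inner_scaleR_left
      by (auto intro!: derivative_eq_intros d simp: algebra_simps)
  qed
  have "integrable \<mu> (\<lambda>y. (v \<bullet> statistic y * dens \<theta> y - d * dens \<theta> y) + d * dens \<theta> y)"
    using int density_integral(1)[OF assms] unfolding deriv by (intro Bochner_Integration.integrable_add) auto
  then have int': "integrable \<mu> (\<lambda>y. v \<bullet> statistic y * dens \<theta> y)"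
    by simp
  have "((\<lambda>t. \<integral>x. dens (\<theta> + t *\<^sub>R v) x \<partial>\<mu>) has_real_derivative 0) (at 0)"
  proof (subst DERIV_cong_ev[OF refl _ refl])
    show "\<forall>\<^sub>F t in nhds 0. (\<integral>x. dens (\<theta> + t *\<^sub>R v) x \<partial>\<mu>) = 1"
      using line_in_domain[OF assms, of v] by eventually_elim (rule density_integral)
  qed simp
  with der have "(\<integral>y. v \<bullet> statistic y * dens \<theta> y - d * dens \<theta> y \<partial>\<mu>) = 0"
    unfolding deriv by (rule DERIV_unique)
  then have "(\<integral>y. v \<bullet> statistic y * dens \<theta> y \<partial>\<mu>) = d"
    using int' density_integral[OF assms] by simp
  with d int' show thesis by (rule that)
qed

lemma inner_statistic_integral:
  assumes "\<theta> \<in> E"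
  shows "integrable \<mu> (\<lambda>x. v \<bullet> statistic x * dens \<theta> x)"
    and "(\<integral>x. v \<bullet> statistic x * dens \<theta> x \<partial>\<mu>) = v \<bullet> mean \<theta>"
proof -
  show "integrable \<mu> (\<lambda>x. v \<bullet> statistic x * dens \<theta> x)"
    by (rule potential_line_derivative_aux[OF assms])
  have int: "integrable \<mu> (\<lambda>x. F k x * dens \<theta> x)" for k
    using potential_line_derivative_aux[OF assms, of "axis k 1"]
    by (auto simp: inner_axis' statistic_def)
  have "(\<integral>x. v \<bullet> statistic x * dens \<theta> x \<partial>\<mu>)
      = (\<integral>x. (\<Sum>k\<in>UNIV. v $ k * (F k x * dens \<theta> x)) \<partial>\<mu>)"
    by (simp add: inner_statistic sum_distrib_right mult.assoc)
  also have "\<dots> = v \<bullet> mean \<theta>"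
    using int by (simp add: mean_def inner_vec_def)
  finally show "(\<integral>x. v \<bullet> statistic x * dens \<theta> x \<partial>\<mu>) = v \<bullet> mean \<theta>" .
qed

lemma potential_line_derivative:
  assumes "\<theta> \<in> E"
  shows "((\<lambda>t. potential (\<theta> + t *\<^sub>R v)) has_real_derivative v \<bullet> mean \<theta>) (at 0)"
  using potential_line_derivative_aux[OF assms, of v] inner_statistic_integral(2)[OF assms, of v]
  by metis

lemma log_density_line_derivative:
  assumes "\<theta> \<in> E"
  shows "((\<lambda>t. C x + (\<theta> + t *\<^sub>R v) \<bullet> statistic x - potential (\<theta> + t *\<^sub>R v))
    has_real_derivative score \<theta> v x) (at 0)"
  unfolding inner_add_left inner_scaleR_left score_def inner_diff_right
  by (auto intro!: derivative_eq_intros potential_line_derivative[OF assms])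

lemma tangent_fun_eq_score:
  assumes "\<theta> \<in> E"
  shows "tangent_fun \<mu> C F \<theta> v = score \<theta> v"
proof
  fix x
  have "((\<lambda>t. dens (\<theta> + t *\<^sub>R v) x) has_real_derivative dens \<theta> x * score \<theta> v x) (at 0)"
    unfolding density_eq
    by (rule derivative_eq_intros log_density_line_derivative[OF assms] refl)+ simp
  then show "tangent_fun \<mu> C F \<theta> v x = score \<theta> v x"
    by (simp add: tangent_fun_def DERIV_imp_deriv)
qed

lemma score_integral:
  assumes "\<theta> \<in> E"
  shows "integrable \<mu> (\<lambda>x. score \<theta> v x * dens \<theta> x)"
    and "(\<integral>x. score \<theta> v x * dens \<theta> x \<partial>\<mu>) = 0"
  using inner_statistic_integral[OF assms, of v] density_integral[OF assms]
  by (simp_all add: score_def inner_diff_right left_diff_distrib)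

lemma partial_deriv_log_likelihood:
  assumes "\<theta> \<in> E"
  shows "partial_deriv j (log_likelihood \<mu> C F x) \<theta> = score \<theta> (axis j 1) x"
  unfolding partial_deriv_def log_likelihood_def density_eq ln_exp
  by (rule DERIV_imp_deriv[OF log_density_line_derivative[OF assms]])

text \<open>In \<open>ln p\<^sub>\<theta>(x)\<close> the sample point occurs only in terms that are affine in \<open>\<theta>\<close>, so the
  second derivatives do not depend on it and factor out of the integral of a score, which is
  zero.\<close>

lemma christoffel1_eq_0:
  assumes "\<theta> \<in> E"
  shows "christoffel1 \<mu> C F \<theta> i j k = 0"
proof -
  (* The number 0 stands for the sample-dependent constant axis j 1 \<bullet> statistic x. *)
  define hess where "hess = deriv (\<lambda>t. 0 - axis j 1 \<bullet> mean (\<theta> + t *\<^sub>R axis i 1)) 0"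
  have "partial_deriv i (partial_deriv j (log_likelihood \<mu> C F x)) \<theta> = hess" for x
  proof -
    have "partial_deriv i (partial_deriv j (log_likelihood \<mu> C F x)) \<theta>
        = deriv (\<lambda>t. axis j 1 \<bullet> statistic x - axis j 1 \<bullet> mean (\<theta> + t *\<^sub>R axis i 1)) 0"
      unfolding partial_deriv_def[of i]
    proof (rule deriv_cong_ev[OF _ refl])
      show "\<forall>\<^sub>F t in nhds 0. partial_deriv j (log_likelihood \<mu> C F x) (\<theta> + t *\<^sub>R axis i 1)
          = axis j 1 \<bullet> statistic x - axis j 1 \<bullet> mean (\<theta> + t *\<^sub>R axis i 1)"
        using line_in_domain[OF assms, of "axis i 1"]
        by eventually_elim (simp add: partial_deriv_log_likelihood score_def inner_diff_right)
    qed
    also have "\<dots> = hess"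
      unfolding hess_def by (rule deriv_const_diff_cong)
    finally show ?thesis .
  qed
  then have "christoffel1 \<mu> C F \<theta> i j k
      = (\<integral>x. hess * (score \<theta> (axis k 1) x * dens \<theta> x) \<partial>\<mu>)"
    by (simp add: christoffel1_def partial_deriv_log_likelihood[OF assms] mult.assoc)
  then show ?thesis
    using score_integral[OF assms, of "axis k 1"] by simp
qed

lemma connector_eq_snd:
  assumes "fst q \<in> E"
  shows "connector \<mu> C F q Z = snd Z"
  by (simp add: connector_def christoffel2_def christoffel1_eq_0[OF assms] vec_eq_iff)


section \<open>The velocity of \<open>\<Phi>\<close>\<close>

abbreviation \<Phi> :: "(real^'n) \<times> (real^'n) \<Rightarrow> 'x \<Rightarrow> complex" where
  "\<Phi> q \<equiv> Phi (tm_point \<mu> C F q)"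

lemma Phi_eq:
  assumes "fst q \<in> E"
  shows "\<Phi> q x = of_real (sqrt (dens (fst q) x)) * exp (\<i> * of_real (score (fst q) (snd q) x) / 2)"
  by (simp add: Phi_def tm_point_def tangent_fun_eq_score[OF assms])

lemma Phi_measurable:
  assumes "fst q \<in> E" shows "\<Phi> q \<in> borel_measurable \<mu>"
  unfolding Phi_eq[OF assms, abs_def] by measurable

lemma norm_Phi:
  assumes "fst q \<in> E" shows "(cmod (\<Phi> q x))\<^sup>2 = dens (fst q) x"
proof -
  have "cmod (exp (\<i> * of_real (score (fst q) (snd q) x) / 2)) = 1"
    by simp
  then show ?thesis
    using density_pos[of "fst q" x] by (simp add: Phi_eq[OF assms] norm_mult less_imp_le)
qed

lemma Phi_in_sphere:
  assumes "fst q \<in> E" shows "\<Phi> q \<in> l2_sphere \<mu>"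
  using Phi_measurable[OF assms] density_integral[OF assms]
  by (simp add: l2_sphere_def L2_def l2_norm_def norm_Phi[OF assms])

text \<open>The split separates from \<open>\<Phi>\<close> the unimodular factor \<open>global_phase\<close> that is constant on the
  sample space.  The potential is constant there too, but it changes the modulus and stays in the
  exponent.\<close>

definition amplitude_exponent :: "(real^'n) \<times> (real^'n) \<Rightarrow> 'x \<Rightarrow> complex" where
  "amplitude_exponent q x =
     of_real (C x + fst q \<bullet> statistic x - potential (fst q)) / 2 + \<i> * of_real (snd q \<bullet> statistic x) / 2"

definition global_phase :: "(real^'n) \<times> (real^'n) \<Rightarrow> complex" where
  "global_phase q = exp (- (\<i> * of_real (snd q \<bullet> mean (fst q)) / 2))"

lemma Phi_factorization:
  assumes "fst q \<in> E"
  shows "\<Phi> q x = exp (amplitude_exponent q x) * global_phase q"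
proof -
  have "sqrt (exp y) = exp (y / 2)" for y :: real
    by (rule real_sqrt_unique) (simp_all add: power2_eq_square flip: exp_add)
  then have sqrt: "complex_of_real (sqrt (dens (fst q) x))
      = exp (of_real (C x + fst q \<bullet> statistic x - potential (fst q)) / 2)"
    by (simp add: density_eq flip: exp_of_real)
  show ?thesis
    unfolding Phi_eq[OF assms] sqrt
    by (simp add: amplitude_exponent_def global_phase_def score_def inner_diff_right
        right_diff_distrib diff_divide_distrib add_diff_eq flip: exp_add)
qed

lemma amplitude_exponent_line_derivative:
  assumes "fst q \<in> E"
  shows "((\<lambda>t. amplitude_exponent (q + t *\<^sub>R Z) x) has_vector_derivative
    of_real (score (fst q) (fst Z) x) / 2 + \<i> * of_real (snd Z \<bullet> statistic x) / 2) (at 0)"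
proof -
  have "((\<lambda>t. (snd q + t *\<^sub>R snd Z) \<bullet> statistic x) has_real_derivative snd Z \<bullet> statistic x) (at 0)"
    unfolding inner_add_left inner_scaleR_left by (auto intro!: derivative_eq_intros)
  note of_real = this[THEN has_vector_derivative_of_real]
    log_density_line_derivative[OF assms, THEN has_vector_derivative_of_real]
  show ?thesis
    unfolding amplitude_exponent_def fst_add snd_add fst_scaleR snd_scaleR
    by (intro has_vector_derivative_add has_vector_derivative_divide has_vector_derivative_mult_right of_real)
qed

text \<open>The pointwise derivative is computed by the product rule for the factorization of \<open>\<Phi>\<close>.
  The phase is differentiable because at any one sample point where \<open>\<Phi>\<close> is differentiable it is
  the quotient of \<open>\<Phi>\<close> by a nonvanishing differentiable factor.  Differentiating its
  argument \<open>snd q \<bullet> mean (fst q)\<close> instead would call for second derivatives of the potential.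
  The logarithmic derivative of the phase goes into \<open>\<kappa>\<close>, along with the centring of the second
  score.\<close>

lemma Phi_velocity:
  assumes "fst q \<in> E"
  obtains D \<kappa> where "has_l2_derivative \<mu> (\<lambda>t. \<Phi> (q + t *\<^sub>R Z)) D"
    "AE x in \<mu>. D x = \<Phi> q x * (of_real (score (fst q) (fst Z) x) / 2
        + \<i> * of_real (score (fst q) (snd Z) x) / 2 + \<kappa>)"
proof -
  have "q \<in> E \<times> UNIV" using assms by (simp add: mem_Times_iff)
  then obtain D where D: "has_l2_derivative \<mu> (\<lambda>t. \<Phi> (q + t *\<^sub>R Z)) D"
    and ptw: "AE x in \<mu>. ((\<lambda>t. \<Phi> (q + t *\<^sub>R Z) x) has_vector_derivative D x) (at 0)"
    using Phi_Gateaux unfolding Phi_Gateaux_differentiable_def by blast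
  define g' where "g' x = complex_of_real (score (fst q) (fst Z) x) / 2
      + \<i> * of_real (snd Z \<bullet> statistic x) / 2" for x
  have g': "((\<lambda>t. amplitude_exponent (q + t *\<^sub>R Z) x) has_vector_derivative g' x) (at 0)" for x
    unfolding g'_def by (rule amplitude_exponent_line_derivative[OF assms])
  have factor: "\<forall>\<^sub>F t in nhds 0. \<Phi> (q + t *\<^sub>R Z) x
      = exp (amplitude_exponent (q + t *\<^sub>R Z) x) * global_phase (q + t *\<^sub>R Z)" for x
    using line_in_domain[OF assms, of "fst Z"] by eventually_elim (simp add: Phi_factorization)
  have exp_g: "((\<lambda>t. exp (amplitude_exponent (q + t *\<^sub>R Z) x)) has_vector_derivative
      g' x * exp (amplitude_exponent q x)) (at 0)" for x
    using field_vector_diff_chain_at[OF g' DERIV_exp] by (simp add: o_def)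
  have exp_minus_g: "((\<lambda>t. exp (- amplitude_exponent (q + t *\<^sub>R Z) x)) has_vector_derivative
      - g' x * exp (- amplitude_exponent q x)) (at 0)" for x
    using field_vector_diff_chain_at[OF has_vector_derivative_minus[OF g'] DERIV_exp]
    by (simp add: o_def)
  obtain x\<^sub>0 where x0: "((\<lambda>t. \<Phi> (q + t *\<^sub>R Z) x\<^sub>0) has_vector_derivative D x\<^sub>0) (at 0)"
    using ptw not_AE_False[OF assms] by (metis (no_types, lifting) eventually_mono)
  obtain u' where u': "((\<lambda>t. global_phase (q + t *\<^sub>R Z)) has_vector_derivative u') (at 0)"
  proof
    have "\<forall>\<^sub>F t in nhds 0. global_phase (q + t *\<^sub>R Z)
        = \<Phi> (q + t *\<^sub>R Z) x\<^sub>0 * exp (- amplitude_exponent (q + t *\<^sub>R Z) x\<^sub>0)"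
      using factor[of x\<^sub>0] by eventually_elim (simp add: exp_minus)
    then show "((\<lambda>t. global_phase (q + t *\<^sub>R Z)) has_vector_derivative
        \<Phi> (q + 0 *\<^sub>R Z) x\<^sub>0 * (- g' x\<^sub>0 * exp (- amplitude_exponent q x\<^sub>0))
          + D x\<^sub>0 * exp (- amplitude_exponent (q + 0 *\<^sub>R Z) x\<^sub>0)) (at 0)"
      by (rule has_vector_derivative_eventually_eq[OF has_vector_derivative_mult[OF x0 exp_minus_g]])
  qed
  (* The second summand turns the statistic in g' into a centred one. *)
  define \<kappa> where "\<kappa> = u' / global_phase q + \<i> * of_real (snd Z \<bullet> mean (fst q)) / 2"
  have "AE x in \<mu>. D x = \<Phi> q x * (of_real (score (fst q) (fst Z) x) / 2
        + \<i> * of_real (score (fst q) (snd Z) x) / 2 + \<kappa>)"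
    using ptw
  proof eventually_elim
    case (elim x)
    have "((\<lambda>t. \<Phi> (q + t *\<^sub>R Z) x) has_vector_derivative
        exp (amplitude_exponent (q + 0 *\<^sub>R Z) x) * u'
          + g' x * exp (amplitude_exponent q x) * global_phase (q + 0 *\<^sub>R Z)) (at 0)"
      by (rule has_vector_derivative_eventually_eq[OF has_vector_derivative_mult[OF exp_g u'] factor])
    with elim have "D x = exp (amplitude_exponent (q + 0 *\<^sub>R Z) x) * u'
          + g' x * exp (amplitude_exponent q x) * global_phase (q + 0 *\<^sub>R Z)"
      by (rule vector_derivative_unique_at)
    also have "\<dots> = \<Phi> q x * (g' x + u' / global_phase q)"
      unfolding Phi_factorization[OF assms]
      by (simp add: field_simps global_phase_def)
    also have "g' x + u' / global_phase q = of_real (score (fst q) (fst Z) x) / 2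
        + \<i> * of_real (score (fst q) (snd Z) x) / 2 + \<kappa>"
      unfolding g'_def \<kappa>_def score_def[of _ "snd Z"] inner_diff_right
      by (simp add: right_diff_distrib diff_divide_distrib)
    finally show ?case .
  qed
  with D show thesis by (rule that)
qed

text \<open>The velocity of \<open>\<Phi>\<close> at \<open>(\<theta>, 0)\<close> in the direction \<open>(v, 0)\<close> is half of
  \<open>\<Phi>\<close> times the score of \<open>v\<close>, up to a multiple of \<open>\<Phi>\<close>.  So square-integrability of velocities
  gives finiteness of the Fisher metric.\<close>

lemma score_square_integrable:
  assumes "\<theta> \<in> E" shows "integrable \<mu> (\<lambda>x. (score \<theta> v x)\<^sup>2 * dens \<theta> x)"
proof -
  define q Z where "q = (\<theta>, 0 :: real^'n)" and "Z = (v, 0 :: real^'n)"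
  have q: "fst q \<in> E" using assms by (simp add: q_def)
  obtain D \<kappa> where D: "has_l2_derivative \<mu> (\<lambda>t. \<Phi> (q + t *\<^sub>R Z)) D"
    "AE x in \<mu>. D x = \<Phi> q x * (of_real (score (fst q) (fst Z) x) / 2
        + \<i> * of_real (score (fst q) (snd Z) x) / 2 + \<kappa>)"
    using Phi_velocity[OF q] .
  have L2: "(\<lambda>x. 2 * (D x - \<kappa> * \<Phi> q x)) \<in> L2 \<mu>"
    using D(1) Phi_in_sphere[OF q]
    by (intro L2_scale L2_diff) (auto simp: has_l2_derivative_def l2_sphere_def)
  have "(\<lambda>x. \<Phi> q x * of_real (score \<theta> v x)) \<in> L2 \<mu>"
  proof (rule L2_cong_AE[OF L2])
    show "(\<lambda>x. \<Phi> q x * of_real (score \<theta> v x)) \<in> borel_measurable \<mu>"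
      using Phi_measurable[OF q] by measurable
    show "AE x in \<mu>. 2 * (D x - \<kappa> * \<Phi> q x) = \<Phi> q x * of_real (score \<theta> v x)"
      using D(2) by eventually_elim (simp add: q_def Z_def score_def field_simps)
  qed
  then have "integrable \<mu> (\<lambda>x. (cmod (\<Phi> q x * of_real (score \<theta> v x)))\<^sup>2)"
    by (rule L2_integrable_square)
  then show ?thesis
    unfolding norm_mult power_mult_distrib norm_Phi[OF q] by (simp add: q_def mult.commute)
qed

text \<open>The score is linear in its direction, so products polarize to squares.\<close>

lemma score_product_integrable:
  assumes "\<theta> \<in> E" shows "integrable \<mu> (\<lambda>x. score \<theta> v x * score \<theta> w x * dens \<theta> x)"
proof -
  have "integrable \<mu> (\<lambda>x. ((score \<theta> (v + w) x)\<^sup>2 * dens \<theta> x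
      - (score \<theta> v x)\<^sup>2 * dens \<theta> x - (score \<theta> w x)\<^sup>2 * dens \<theta> x) / 2)"
    using score_square_integrable[OF assms] by auto
  moreover have "((score \<theta> (v + w) x)\<^sup>2 * dens \<theta> x
      - (score \<theta> v x)\<^sup>2 * dens \<theta> x - (score \<theta> w x)\<^sup>2 * dens \<theta> x) / 2
      = score \<theta> v x * score \<theta> w x * dens \<theta> x" for x
    by (simp add: score_def inner_add_left power2_sum distrib_right mult.assoc)
  ultimately show ?thesis by simp
qed

text \<open>As scores have mean zero, \<open>\<kappa>\<close> is the component of the velocity along \<open>\<Phi>\<close>.\<close>

lemma velocity_orthogonal_to_Phi:
  assumes q: "fst q \<in> E"
    and D: "D \<in> L2 \<mu>" "AE x in \<mu>. D x = \<Phi> q x * (of_real (score (fst q) v x) / 2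
        + \<i> * of_real (score (fst q) w x) / 2 + \<kappa>)"
  shows "AE x in \<mu>. D x - l2_inner \<mu> (\<Phi> q) D * \<Phi> q x
    = \<Phi> q x * (of_real (score (fst q) v x) / 2 + \<i> * of_real (score (fst q) w x) / 2)"
proof -
  note [measurable] = Phi_measurable[OF q]
  have "l2_inner \<mu> (\<Phi> q) D = l2_inner \<mu> (\<Phi> q) (\<lambda>x. \<Phi> q x * (of_real (score (fst q) v x) / 2
        + \<i> * of_real (score (fst q) w x) / 2 + \<kappa>))"
    by (rule l2_inner_cong_AE) (use D L2_measurable[OF D(1)] in auto)
  also have "\<dots> = (\<integral>x. of_real (score (fst q) v x * dens (fst q) x) / 2
      + \<i> * (of_real (score (fst q) w x * dens (fst q) x) / 2) + \<kappa> * of_real (dens (fst q) x) \<partial>\<mu>)"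
  proof -
    have "cnj (\<Phi> q x) * (\<Phi> q x * y) = of_real (dens (fst q) x) * y" for x y
      using norm_Phi[OF q, of x]
      by (metis complex_norm_square mult.assoc mult.commute)
    then show ?thesis
      unfolding l2_inner_def by (simp only:) (simp add: algebra_simps)
  qed
  also have "\<dots> = \<kappa>"
  proof -
    have "integrable \<mu> (\<lambda>x. complex_of_real (score (fst q) v x * dens (fst q) x))" for v
      using score_integral(1)[OF q] by (rule integrable_of_real)
    moreover have "integrable \<mu> (\<lambda>x. complex_of_real (dens (fst q) x))"
      using density_integral(1)[OF q] by (rule integrable_of_real)
    ultimately show ?thesis
      using score_integral(2)[OF q] density_integral(2)[OF q]
      by (simp del: of_real_mult)
  qed
  finally have "l2_inner \<mu> (\<Phi> q) D = \<kappa>" .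
  with D(2) show ?thesis
    by (auto simp: algebra_simps elim!: eventually_mono)
qed

lemma fubini_study_Phi:
  assumes q: "fst q \<in> E"
  shows "fubini_study \<mu> (\<lambda>t. proj_Phi \<mu> C F (q + t *\<^sub>R Z)) (\<lambda>t. proj_Phi \<mu> C F (q + t *\<^sub>R Z'))
    = Complex (dombrowski_g \<mu> C F q Z Z' / 4) (dombrowski_omega \<mu> C F q Z Z' / 4)"
proof -
  define l u l' u' where "l = score (fst q) (fst Z)" and "u = score (fst q) (snd Z)"
    and "l' = score (fst q) (fst Z')" and "u' = score (fst q) (snd Z')"
  define V where "V v w x = \<Phi> q x * (of_real (score (fst q) v x) / 2
      + \<i> * of_real (score (fst q) w x) / 2)" for v w x
  have V [measurable]: "V v w \<in> borel_measurable \<mu>" for v w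
    unfolding V_def using Phi_measurable[OF q] by measurable
  obtain D \<kappa> where D: "has_l2_derivative \<mu> (\<lambda>t. \<Phi> (q + t *\<^sub>R Z)) D"
    "AE x in \<mu>. D x = \<Phi> q x * (of_real (score (fst q) (fst Z) x) / 2
        + \<i> * of_real (score (fst q) (snd Z) x) / 2 + \<kappa>)"
    using Phi_velocity[OF q] .
  obtain D' \<kappa>' where D': "has_l2_derivative \<mu> (\<lambda>t. \<Phi> (q + t *\<^sub>R Z')) D'"
    "AE x in \<mu>. D' x = \<Phi> q x * (of_real (score (fst q) (fst Z') x) / 2
        + \<i> * of_real (score (fst q) (snd Z') x) / 2 + \<kappa>')"
    using Phi_velocity[OF q] .
  have DL2: "D \<in> L2 \<mu>" "D' \<in> L2 \<mu>"
    using D(1) D'(1) by (auto simp: has_l2_derivative_def)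
  have PhiL2: "\<Phi> q \<in> L2 \<mu>"
    using Phi_in_sphere[OF q] by (simp add: l2_sphere_def)
  have "fubini_study \<mu> (\<lambda>t. proj_Phi \<mu> C F (q + t *\<^sub>R Z)) (\<lambda>t. proj_Phi \<mu> C F (q + t *\<^sub>R Z'))
      = l2_inner \<mu> (\<lambda>x. D x - l2_inner \<mu> (\<Phi> q) D * \<Phi> q x)
          (\<lambda>x. D' x - l2_inner \<mu> (\<Phi> q) D' * \<Phi> q x)"
    unfolding proj_Phi_def
    by (rule fubini_study_curves[OF D(1) D'(1)]) (use Phi_in_sphere[OF q] in simp_all)
  also have "\<dots> = l2_inner \<mu> (V (fst Z) (snd Z)) (V (fst Z') (snd Z'))"
    using velocity_orthogonal_to_Phi[OF q DL2(1) D(2)] velocity_orthogonal_to_Phi[OF q DL2(2) D'(2)]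
    by (intro l2_inner_cong_AE V L2_measurable[OF L2_diff] L2_scale DL2 PhiL2)
       (simp_all add: V_def)
  also have "\<dots> = (\<integral>x. of_real ((l x * l' x * dens (fst q) x + u x * u' x * dens (fst q) x) / 4)
      + \<i> * of_real ((l x * u' x * dens (fst q) x - u x * l' x * dens (fst q) x) / 4) \<partial>\<mu>)"
  proof -
    have "cnj (V (fst Z) (snd Z) x) * V (fst Z') (snd Z') x
        = (of_real (l x) / 2 - \<i> * of_real (u x) / 2) * (of_real (l' x) / 2 + \<i> * of_real (u' x) / 2)
          * of_real (dens (fst q) x)" for x
    proof -
      have "\<Phi> q x * cnj (\<Phi> q x) = of_real (dens (fst q) x)"
        using norm_Phi[OF q, of x] by (simp add: complex_norm_square[symmetric])
      then show ?thesis
        unfolding V_def l_def u_def l'_def u'_def by (simp add: mult.assoc mult.left_commute)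
    qed
    also have "(of_real (l x) / 2 - \<i> * of_real (u x) / 2) * (of_real (l' x) / 2 + \<i> * of_real (u' x) / 2)
          * of_real (dens (fst q) x)
        = of_real ((l x * l' x * dens (fst q) x + u x * u' x * dens (fst q) x) / 4)
      + \<i> * of_real ((l x * u' x * dens (fst q) x - u x * l' x * dens (fst q) x) / 4)" for x
      by (simp add: complex_eq_iff algebra_simps)
    finally show ?thesis unfolding l2_inner_def by simp
  qed
  also have "\<dots> = of_real (dombrowski_g \<mu> C F q Z Z' / 4) + \<i> * of_real (dombrowski_omega \<mu> C F q Z Z' / 4)"
  proof -
    have int: "integrable \<mu> (\<lambda>x. l x * l' x * dens (fst q) x)"
      "integrable \<mu> (\<lambda>x. u x * u' x * dens (fst q) x)"
      "integrable \<mu> (\<lambda>x. l x * u' x * dens (fst q) x)"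
      "integrable \<mu> (\<lambda>x. u x * l' x * dens (fst q) x)"
      unfolding l_def u_def l'_def u'_def by (intro score_product_integrable q)+
    define G W where "G x = (l x * l' x * dens (fst q) x + u x * u' x * dens (fst q) x) / 4"
      and "W x = (l x * u' x * dens (fst q) x - u x * l' x * dens (fst q) x) / 4" for x
    have "integrable \<mu> G" "integrable \<mu> W"
      unfolding G_def W_def using int by auto
    moreover have GW: "integral\<^sup>L \<mu> G = dombrowski_g \<mu> C F q Z Z' / 4"
      "integral\<^sup>L \<mu> W = dombrowski_omega \<mu> C F q Z Z' / 4"
      unfolding G_def W_def dombrowski_g_def dombrowski_omega_def fisher_def horizontal_def
        vertical_def connector_eq_snd[OF q] tangent_fun_eq_score[OF q]
        l_def[symmetric] u_def[symmetric] l'_def[symmetric] u'_def[symmetric]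
      using int by simp_all
    ultimately show ?thesis
      unfolding G_def[symmetric] W_def[symmetric] GW[symmetric] by simp
  qed
  finally show ?thesis
    by (simp add: complex_eq_iff)
qed

lemma proj_Phi_differentiable:
  assumes q: "fst q \<in> E"
  shows "proj_differentiable \<mu> (\<lambda>t. proj_Phi \<mu> C F (q + t *\<^sub>R Z))"
proof -
  obtain D where "has_l2_derivative \<mu> (\<lambda>t. \<Phi> (q + t *\<^sub>R Z)) D"
    using Phi_velocity[OF q] by blast
  then show ?thesis
    unfolding proj_Phi_def by (rule proj_differentiable_curve) (use Phi_in_sphere[OF q] in simp)
qed

end

theorem proposition3p1:
  fixes \<mu> :: "'x measure"
    and E :: "(real^'n::finite) set"
    and C :: "'x \<Rightarrow> real"
    and F :: "'n \<Rightarrow> 'x \<Rightarrow> real"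
  assumes "exponential_family \<mu> E C F"
    and "differentiates_under_integral \<mu> E C F"
    and "Phi_Gateaux_differentiable \<mu> E C F"
  shows "\<forall>q\<in>E \<times> UNIV.
           Phi (tm_point \<mu> C F q) \<in> l2_sphere \<mu> \<and>
           (\<forall>Z. proj_differentiable \<mu> (\<lambda>t. proj_Phi \<mu> C F (q + t *\<^sub>R Z))) \<and>
           (\<forall>Z Z'. pullback_form (proj_Phi \<mu> C F) (g_FS \<mu>) q Z Z' = 1/4 * dombrowski_g \<mu> C F q Z Z') \<and>
           (\<forall>Z Z'. pullback_form (proj_Phi \<mu> C F) (omega_FS \<mu>) q Z Z' = 1/4 * dombrowski_omega \<mu> C F q Z Z')"
proof -
  interpret regular_exponential_family \<mu> E C F
    by (rule regular_exponential_family.intro[OF assms])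
  show ?thesis
    by (auto simp: mem_Times_iff Phi_in_sphere proj_Phi_differentiable pullback_form_def
        g_FS_def omega_FS_def fubini_study_Phi)
qed

end
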